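(* Let $a=(a_n)$ be a sequence of positive real numbers, $\lambda=(\lambda_n)$ a negative real sequence, and $b=(b_n)$ a complex sequence with $b_n\neq 0$ for all $n\in\mathbb{N}$; for each space $X$ considered below, $a\in\ell^\infty$ (with $a\in c$ if $X=c$) and $b\in X$. Suppose that: (C1) $(a_n)$ and $(|\lambda_n|)$ uniformly exponentially decay with $\alpha=1$; (C2) $(|b_n|)$ uniformly exponentially decays; (C3) $(g_n)$ uniformly exponentially decays, where $g_n:=(a_n-\lambda_n)/|b_n|$; (C4) $(a_n/|b_n|)$ uniformly exponentially decays; (C5** ) there exist sequences $(\gamma_n)$, $(\omega_n)$ such that $\gamma_n\le|\lambda_n|/a_n\le\omega_n$ for all $n\in\mathbb{N}$ and, moreover, $(\omega_n-1)$ and $(1/\gamma_n-1)$ are positive sequences in $\ell^1$. Then $k(\lambda)\in X^*$ for all $X\in\{\ell^p\,(1\le p\le\infty),\,c,\,c_0\}$, and $T_{k(\lambda)}=A+bk(\lambda)$ is diagonalizable if $X=\ell^p$ for $1\le p\le\infty$ or $X=c_0$.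
   Context: $\mathbb{N}$ is the set of positive integers. $\ell^p$, $c$ (convergent sequences, sup norm) and $c_0$ (null sequences, sup norm) are complex Banach sequence spaces. $A:X\to X$ is the bounded diagonal operator $(x_n)\mapsto(a_nx_n)$. A sequence $k=(k_n)$ is said to be in $X^*$ if $kx=\sum_{n=1}^\infty k_nx_n$ defines a bounded linear functional on $X$. For such $k$, $T_k:=A+bk$, i.e. $T_kx=Ax+b\,(kx)$. For sequences $x=(x_n)$, $y=(y_n)$ with the $y_n$ nonzero and pairwise distinct, $$\pi_n(x,y):=\lim_{N\to\infty}\prod_{m=1,\,m\ne n}^N\frac{1-x_m/y_n}{1-y_m/y_n},\quad n\in\mathbb{N}.$$ The sequence of feedback gains $k(\lambda)=(k_n(\lambda))$ is $$k_n(\lambda):=-\frac{a_n-\lambda_n}{b_n}\,\pi_n(\lambda,a),\quad n\in\mathbb{N}.$$ $T_k$ is diagonalizable if there exist bounded linear operators $P,Q:X\to X$, inverses of each other, with $T_k=P\Lambda Q$, where $\Lambda=\mathrm{diag}(\mu_1,\mu_2,\ldots)$ and $\{\mu_1,\mu_2,\ldots\}=\Sigma_{\mathrm{disc}}(T_k)$, the discrete spectrum of $T_k$ (isolated eigenvalues of finite algebraic multiplicity). A positive real sequence $(x_n)$ uniformly exponentially decays if there exist $\alpha>0$ and $r\in(0,1)$ such that $x_m/x_n\le\alpha r^{m-n}$ for all $m\ge n$; "with $\alpha=1$" means that $\alpha$ can be taken equal to $1$. *)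

theory Defs
  imports "HOL-Analysis.Analysis"
begin

text \<open>Sequences are indexed from 0 instead of 1; every notion below depends only on
  differences of indices or is invariant under this shift.\<close>

type_synonym cseq = "nat \<Rightarrow> complex"

record seq_space =
  seqs :: "cseq set"
  seq_norm :: "cseq \<Rightarrow> real"

definition sup_norm :: "cseq \<Rightarrow> real" where
  "sup_norm x = (SUP n. norm (x n))"

definition ell :: "ennreal \<Rightarrow> seq_space" where
  "ell p =
    (if p = \<infinity> then \<lparr>seqs = {x. bounded (range x)}, seq_norm = sup_norm\<rparr>
     else \<lparr>seqs = {x. summable (\<lambda>n. norm (x n) powr enn2real p)},
           seq_norm = (\<lambda>x. (\<Sum>n. norm (x n) powr enn2real p) powr (1 / enn2real p))\<rparr>)"

definition c_space :: seq_space where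
  "c_space = \<lparr>seqs = {x. convergent x}, seq_norm = sup_norm\<rparr>"

definition c0_space :: seq_space where
  "c0_space = \<lparr>seqs = {x. x \<longlonglongrightarrow> 0}, seq_norm = sup_norm\<rparr>"

definition bounded_op :: "seq_space \<Rightarrow> (cseq \<Rightarrow> cseq) \<Rightarrow> bool" where
  "bounded_op X T \<longleftrightarrow>
     (\<forall>x\<in>seqs X. T x \<in> seqs X) \<and>
     (\<forall>x\<in>seqs X. \<forall>y\<in>seqs X. T (\<lambda>n. x n + y n) = (\<lambda>n. T x n + T y n)) \<and>
     (\<forall>x\<in>seqs X. \<forall>z. T (\<lambda>n. z * x n) = (\<lambda>n. z * T x n)) \<and>
     (\<exists>C. \<forall>x\<in>seqs X. seq_norm X (T x) \<le> C * seq_norm X x)"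

definition seq_functional :: "cseq \<Rightarrow> cseq \<Rightarrow> complex" where
  "seq_functional k x = (\<Sum>n. k n * x n)"

text \<open>Linearity of the functional is automatic once all the series converge.\<close>

definition seq_dual :: "seq_space \<Rightarrow> cseq set" where
  "seq_dual X = {k.
     (\<forall>x\<in>seqs X. summable (\<lambda>n. k n * x n)) \<and>
     (\<exists>C. \<forall>x\<in>seqs X. norm (seq_functional k x) \<le> C * seq_norm X x)}"

definition diag_op :: "cseq \<Rightarrow> cseq \<Rightarrow> cseq" where
  "diag_op \<mu> x = (\<lambda>n. \<mu> n * x n)"

definition feedback_op :: "cseq \<Rightarrow> cseq \<Rightarrow> cseq \<Rightarrow> cseq \<Rightarrow> cseq" where
  "feedback_op a b k x = (\<lambda>n. diag_op a x n + b n * seq_functional k x)"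

definition pi_seq :: "cseq \<Rightarrow> cseq \<Rightarrow> cseq" where
  "pi_seq x y n =
     lim (\<lambda>N. \<Prod>m\<in>{..<N} - {n}. (1 - x m / y n) / (1 - y m / y n))"

definition gain :: "cseq \<Rightarrow> cseq \<Rightarrow> cseq \<Rightarrow> cseq" where
  "gain a b l n = - ((a n - l n) / b n) * pi_seq l a n"

definition shift_op :: "(cseq \<Rightarrow> cseq) \<Rightarrow> complex \<Rightarrow> cseq \<Rightarrow> cseq" where
  "shift_op T z x = (\<lambda>n. T x n - z * x n)"

definition op_spectrum :: "seq_space \<Rightarrow> (cseq \<Rightarrow> cseq) \<Rightarrow> complex set" where
  "op_spectrum X T = {z. \<not> (\<exists>R. bounded_op X R \<and>
     (\<forall>x\<in>seqs X. R (shift_op T z x) = x \<and> shift_op T z (R x) = x))}"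

definition is_eigenvalue :: "seq_space \<Rightarrow> (cseq \<Rightarrow> cseq) \<Rightarrow> complex \<Rightarrow> bool" where
  "is_eigenvalue X T z \<longleftrightarrow> (\<exists>x\<in>seqs X. x \<noteq> (\<lambda>_. 0) \<and> T x = (\<lambda>n. z * x n))"

definition gen_eigenspace :: "seq_space \<Rightarrow> (cseq \<Rightarrow> cseq) \<Rightarrow> complex \<Rightarrow> cseq set" where
  "gen_eigenspace X T z = {x\<in>seqs X. \<exists>j. (shift_op T z ^^ j) x = (\<lambda>_. 0)}"

definition finite_dim :: "cseq set \<Rightarrow> bool" where
  "finite_dim V \<longleftrightarrow>
     (\<exists>B. finite B \<and> (\<forall>x\<in>V. \<exists>c. x = (\<lambda>n. \<Sum>v\<in>B. c v * v n)))"

text \<open>The algebraic multiplicity of an eigenvalue is the dimension of its generalized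
  eigenspace. An eigenvalue is isolated if it is an isolated point of the spectrum.\<close>

definition disc_spectrum :: "seq_space \<Rightarrow> (cseq \<Rightarrow> cseq) \<Rightarrow> complex set" where
  "disc_spectrum X T = {z. is_eigenvalue X T z \<and> z isolated_in op_spectrum X T \<and>
     finite_dim (gen_eigenspace X T z)}"

text \<open>The condition that the diagonal operator acts on the space makes the composition
  meaningful, since operators are total functions here and arbitrary outside the space.\<close>

definition diagonalizable :: "seq_space \<Rightarrow> (cseq \<Rightarrow> cseq) \<Rightarrow> bool" where
  "diagonalizable X T \<longleftrightarrow>
     (\<exists>P Q \<mu>. bounded_op X P \<and> bounded_op X Q \<and> bounded_op X (diag_op \<mu>) \<and>
        (\<forall>x\<in>seqs X. P (Q x) = x \<and> Q (P x) = x) \<and>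
        (\<forall>x\<in>seqs X. T x = P (diag_op \<mu> (Q x))) \<and>
        range \<mu> = disc_spectrum X T)"

definition unif_exp_decay_with :: "real \<Rightarrow> (nat \<Rightarrow> real) \<Rightarrow> bool" where
  "unif_exp_decay_with \<alpha> x \<longleftrightarrow> (\<forall>n. 0 < x n) \<and>
     (\<exists>r. 0 < r \<and> r < 1 \<and> (\<forall>n m. n \<le> m \<longrightarrow> x m / x n \<le> \<alpha> * r ^ (m - n)))"

definition unif_exp_decay :: "(nat \<Rightarrow> real) \<Rightarrow> bool" where
  "unif_exp_decay x \<longleftrightarrow> (\<exists>\<alpha>>0. unif_exp_decay_with \<alpha> x)"

end

theory Submission
  imports Defs
begin

text \<open>Write \<open>c n = - l n > 0\<close>, so that the eigenvalues to be assigned are \<open>- c n\<close>. An eigenvector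
  \<open>x\<close> of \<open>A + b k\<close> for \<open>- c n\<close> satisfies \<open>(a m + c n) x m = - b m (k x)\<close>. Up to scaling it is
  therefore column \<open>n\<close> of
  \<open>P m n = (b m / b n) (a n + c n) / (a m + c n)\<close>,
  whatever the functional \<open>k\<close> is; the gains only have to make \<open>k\<close> take the right values on these
  columns. \<open>P\<close> is a diagonally scaled Cauchy matrix, and the classical formula for the inverse of
  a Cauchy matrix suggests the inverse
  \<open>Q n m = (b n / b m) (a m + c m) / (a m + c n) \<pi>\<^sub>m(l, a) \<pi>\<^sub>n(a, l)\<close>.

  The decay conditions make both matrices exponentially localized: \<open>\<bar>P m n\<bar>\<close> and \<open>\<bar>Q m n\<bar>\<close> are
  at most a constant times \<open>r ^ \<bar>m - n\<bar>\<close> (lemmas \<open>eigvec_mat_localized\<close> and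
  \<open>coeff_mat_localized\<close>). On one side of the diagonal this is the decay of \<open>b\<close>, on the other that
  of \<open>(a + c) / b\<close>. The products \<open>\<pi>\<^sub>n\<close> are bounded uniformly in \<open>n\<close>, because \<open>a\<close> and \<open>c\<close> decay with
  constant \<open>1\<close> and the ratios \<open>c n / a n\<close> and \<open>a n / c n\<close> exceed \<open>1\<close> at most by a summable sequence
  (lemma \<open>norm_partial_pi_le\<close>). By Schur's test a localized matrix is a bounded operator on
  every \<open>\<ell>\<^sup>p\<close> and on \<open>c\<^sub>0\<close> (lemma \<open>bounded_op_mat_op\<close>).

  Truncating all indices and products at \<open>N\<close> gives exact algebraic identities: the \<open>N \<times> N\<close>
  sections of \<open>P\<close> and \<open>Q\<close> are inverse to each other, and the truncated gains send column \<open>n\<close> of \<open>P\<close>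
  to \<open>- (a n + c n) / b n\<close>. Both are divided difference identities for polynomials of degree
  \<open>N - 1\<close> with nodes \<open>a m\<close> (lemma \<open>coeff_eq_divided_difference\<close>). Localization dominates all the
  sums uniformly in \<open>N\<close>, so Tannery's theorem carries the identities over to the infinite
  matrices acting on bounded sequences: \<open>P Q = Q P = 1\<close> and \<open>(A + b k) P = P diag(- c)\<close> (lemmas
  \<open>eigvec_mat_inverse\<close> and \<open>feedback_op_eigvec_mat\<close>).

  The gains are absolutely summable, hence a functional on all the spaces. Finally
  the numbers \<open>- c n\<close> are separated from each other, so that they are exactly the
  discrete spectrum of \<open>A + b k = P diag(- c) Q\<close> (lemma \<open>diagonalizable_of_similar\<close>).\<close>

section \<open>Truncated Cauchy matrices\<close>

text \<open>Compare the coefficients of degree \<open>card S - 1\<close> in the Lagrange interpolation formula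
  for \<open>q\<close> with nodes \<open>S\<close>: every fundamental polynomial is monic up to its denominator.\<close>

lemma coeff_eq_divided_difference:
  fixes q :: "'a :: field poly"
  assumes fin: "finite S" and deg: "degree q < card S"
  shows "coeff q (card S - 1) = (\<Sum>s\<in>S. poly q s / (\<Prod>t\<in>S - {s}. s - t))"
proof -
  define L where "L s = (\<Prod>t\<in>S - {s}. [:- t, 1:])" for s
  have polyL: "poly (L s) u = (\<Prod>t\<in>S - {s}. u - t)" for s u
    by (simp add: L_def poly_prod)
  have degL: "degree (L s) = card S - 1" if "s \<in> S" for s
    using that fin by (simp add: L_def degree_prod_sum_eq card_Diff_singleton)
  have coeffL: "coeff (L s) (card S - 1) = 1" if "s \<in> S" for s
  proof -
    have "lead_coeff (L s) = 1"
      by (simp add: L_def lead_coeff_prod)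
    then show ?thesis
      using degL[OF that] by simp
  qed
  define R where "R = (\<Sum>s\<in>S. smult (poly q s / (\<Prod>t\<in>S - {s}. s - t)) (L s))"
  have "q = R"
  proof (rule poly_eqI_degree[of S])
    fix u assume u: "u \<in> S"
    have "poly R u = (\<Sum>s\<in>S. if s = u then poly q u else 0)"
      unfolding R_def poly_sum
    proof (rule sum.cong)
      fix s assume "s \<in> S"
      have "(\<Prod>t\<in>S - {s}. u - t) = 0" if "s \<noteq> u"
        using that u fin by auto
      moreover have "(\<Prod>t\<in>S - {u}. u - t) \<noteq> 0"
        using fin by auto
      ultimately show "poly (smult (poly q s / (\<Prod>t\<in>S - {s}. s - t)) (L s)) u
          = (if s = u then poly q u else 0)"
        by (auto simp: polyL)
    qed simp
    then show "poly q u = poly R u"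
      using u fin by simp
  next
    show "degree q < card S" by fact
    have "degree R \<le> card S - 1"
      unfolding R_def
      by (intro degree_sum_le fin order.trans[OF degree_smult_le]) (simp add: degL)
    then show "degree R < card S"
      using deg by linarith
  qed
  then have "coeff q (card S - 1) = coeff R (card S - 1)"
    by simp
  also have "\<dots> = (\<Sum>s\<in>S. poly q s / (\<Prod>t\<in>S - {s}. s - t))"
    by (simp add: R_def coeff_sum coeffL del: One_nat_def)
  finally show ?thesis .
qed

definition partial_pi :: "cseq \<Rightarrow> cseq \<Rightarrow> nat \<Rightarrow> cseq" where
  "partial_pi x y N n = (\<Prod>m\<in>{..<N} - {n}. (1 - x m / y n) / (1 - y m / y n))"

lemma partial_pi_eq:
  assumes "y n \<noteq> 0"
  shows "partial_pi x y N n = (\<Prod>m\<in>{..<N} - {n}. y n - x m) / (\<Prod>m\<in>{..<N} - {n}. y n - y m)"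
proof -
  have "(1 - x m / y n) / (1 - y m / y n) = (y n - x m) / (y n - y m)" for m
    using assms by (cases "y n = y m") (auto simp: divide_simps)
  then show ?thesis
    by (simp add: partial_pi_def prod_dividef)
qed

text \<open>The factors \<open>(a m - l m) * partial_pi l a N m\<close> are residues of the rational function
  with zeros \<open>l k\<close> and poles \<open>a k\<close>. Dividing by \<open>a m - l j\<close> removes one zero, so that the
  remaining numerator \<open>\<Prod>k\<noteq>j. (z - l k)\<close> has degree \<open>N - 1\<close> and divided differences apply.\<close>

lemma residue_div_root:
  fixes a l :: cseq
  assumes "a m \<noteq> 0" and "a m \<noteq> l j" and "m < N" and "j < N"
  shows "(a m - l m) * partial_pi l a N m / (a m - l j)
    = (\<Prod>k\<in>{..<N} - {j}. a m - l k) / (\<Prod>k\<in>{..<N} - {m}. a m - a k)"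
proof -
  have "(a m - l m) * (\<Prod>k\<in>{..<N} - {m}. a m - l k) = (\<Prod>k<N. a m - l k)"
    using assms by (subst prod.remove[of _ m]) auto
  also have "\<dots> = (a m - l j) * (\<Prod>k\<in>{..<N} - {j}. a m - l k)"
    using assms by (subst prod.remove[of _ j]) auto
  finally show ?thesis
    using assms by (simp add: partial_pi_eq)
qed

text \<open>For node set \<open>{a m | m < N}\<close> the coefficient in question is the leading one, \<open>1\<close>; after
  adding the node \<open>l n\<close> it is \<open>0\<close>.\<close>

lemma sum_residues:
  fixes a l :: cseq
  assumes nz: "\<And>m. a m \<noteq> 0" and ne: "\<And>m n. a m \<noteq> l n"
    and inj: "inj_on a {..<N}" and j: "j < N"
  shows "(\<Sum>m<N. (a m - l m) * partial_pi l a N m / (a m - l j)) = 1"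
proof -
  define q where "q = (\<Prod>k\<in>{..<N} - {j}. [:- l k, 1:])"
  have deg: "degree q = N - 1"
    using j by (simp add: q_def degree_prod_sum_eq)
  have "lead_coeff q = 1"
    by (simp add: q_def lead_coeff_prod)
  moreover have "card (a ` {..<N}) = N"
    using inj by (simp add: card_image)
  ultimately have "1 = coeff q (card (a ` {..<N}) - 1)"
    by (simp add: deg)
  also have "\<dots> = (\<Sum>s\<in>a ` {..<N}. poly q s / (\<Prod>t\<in>a ` {..<N} - {s}. s - t))"
    using j deg inj by (intro coeff_eq_divided_difference) (auto simp: card_image)
  also have "\<dots> = (\<Sum>m<N. poly q (a m) / (\<Prod>t\<in>a ` {..<N} - {a m}. a m - t))"
    using inj by (simp add: sum.reindex)
  also have "\<dots> = (\<Sum>m<N. (a m - l m) * partial_pi l a N m / (a m - l j))"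
  proof (rule sum.cong)
    fix m assume m: "m \<in> {..<N}"
    have "a ` {..<N} - {a m} = a ` ({..<N} - {m})"
      using m inj by (auto simp: inj_on_def)
    moreover have "inj_on a ({..<N} - {m})"
      using inj by (rule inj_on_subset) auto
    ultimately have "(\<Prod>t\<in>a ` {..<N} - {a m}. a m - t) = (\<Prod>k\<in>{..<N} - {m}. a m - a k)"
      by (simp add: prod.reindex)
    then show "poly q (a m) / (\<Prod>t\<in>a ` {..<N} - {a m}. a m - t)
        = (a m - l m) * partial_pi l a N m / (a m - l j)"
      using m j by (simp add: residue_div_root nz ne q_def poly_prod)
  qed simp
  finally show ?thesis ..
qed

lemma sum_residues_pair:
  fixes a l :: cseq
  assumes nz: "\<And>m. a m \<noteq> 0" and ne: "\<And>m n. a m \<noteq> l n"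
    and inj: "inj_on a {..<N}" and j: "j < N"
  shows "(\<Sum>m<N. (a m - l m) * partial_pi l a N m / ((a m - l n) * (a m - l j)))
    = - (\<Prod>k\<in>{..<N} - {j}. l n - l k) / (\<Prod>k<N. l n - a k)"
proof -
  define q where "q = (\<Prod>k\<in>{..<N} - {j}. [:- l k, 1:])"
  define S where "S = insert (l n) (a ` {..<N})"
  have new: "l n \<notin> a ` {..<N}"
    using ne by (metis imageE)
  have card: "card S = Suc N"
    using inj new by (simp add: S_def card_image)
  have deg: "degree q = N - 1"
    using j by (simp add: q_def degree_prod_sum_eq)
  have "0 = coeff q (card S - 1)"
    using j by (simp add: card coeff_eq_0 deg)
  also have "\<dots> = (\<Sum>s\<in>S. poly q s / (\<Prod>t\<in>S - {s}. s - t))"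
    using j deg card by (intro coeff_eq_divided_difference) (auto simp: S_def)
  also have "\<dots> = poly q (l n) / (\<Prod>t\<in>a ` {..<N}. l n - t)
      + (\<Sum>s\<in>a ` {..<N}. poly q s / (\<Prod>t\<in>S - {s}. s - t))"
    using new by (simp add: S_def)
  also have "(\<Prod>t\<in>a ` {..<N}. l n - t) = (\<Prod>k<N. l n - a k)"
    using inj by (simp add: prod.reindex)
  also have "(\<Sum>s\<in>a ` {..<N}. poly q s / (\<Prod>t\<in>S - {s}. s - t))
      = (\<Sum>m<N. poly q (a m) / (\<Prod>t\<in>S - {a m}. a m - t))"
    using inj by (simp add: sum.reindex)
  also have "\<dots> = (\<Sum>m<N. (a m - l m) * partial_pi l a N m / ((a m - l n) * (a m - l j)))"
  proof (rule sum.cong)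
    fix m assume m: "m \<in> {..<N}"
    have "l n \<noteq> a m"
      using ne by metis
    then have "S - {a m} = insert (l n) (a ` ({..<N} - {m}))"
      using m inj by (auto simp: inj_on_def S_def)
    moreover have "inj_on a ({..<N} - {m})"
      using inj by (rule inj_on_subset) auto
    moreover have "l n \<notin> a ` ({..<N} - {m})"
      using new by auto
    ultimately have "(\<Prod>t\<in>S - {a m}. a m - t) = (a m - l n) * (\<Prod>k\<in>{..<N} - {m}. a m - a k)"
      by (simp add: prod.reindex)
    moreover have "poly q (a m) / (\<Prod>k\<in>{..<N} - {m}. a m - a k)
        = (a m - l m) * partial_pi l a N m / (a m - l j)"
      using m j by (simp add: residue_div_root nz ne q_def poly_prod)
    ultimately show "poly q (a m) / (\<Prod>t\<in>S - {a m}. a m - t)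
        = (a m - l m) * partial_pi l a N m / ((a m - l n) * (a m - l j))"
      by (metis divide_divide_eq_left mult.commute)
  qed simp
  finally show ?thesis
    by (simp add: q_def poly_prod add_eq_0_iff)
qed

text \<open>Here the Cauchy matrix \<open>1 / (a m - l j)\<close> is multiplied from the left by its inverse. The
  sum over \<open>m\<close> produces \<open>\<Prod>k\<noteq>j. (l n - l k)\<close>, which vanishes unless \<open>n = j\<close>; for \<open>n = j\<close> it
  cancels against \<open>partial_pi a l N n\<close>.\<close>

lemma cauchy_inverse:
  fixes a l :: cseq
  assumes nz: "\<And>m. a m \<noteq> 0" "\<And>m. l m \<noteq> 0" and ne: "\<And>m n. a m \<noteq> l n"
    and inj: "inj_on a {..<N}" "inj_on l {..<N}" and n: "n < N" and j: "j < N"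
  shows "(\<Sum>m<N. (a n - l n) * (a m - l m) * partial_pi l a N m * partial_pi a l N n
      / ((a m - l n) * (a m - l j))) = of_bool (n = j)"
proof -
  have "(\<Sum>m<N. (a n - l n) * (a m - l m) * partial_pi l a N m * partial_pi a l N n
      / ((a m - l n) * (a m - l j)))
    = (a n - l n) * partial_pi a l N n
      * (\<Sum>m<N. (a m - l m) * partial_pi l a N m / ((a m - l n) * (a m - l j)))"
    by (simp add: sum_distrib_left mult_ac)
  also have "\<dots> = - ((a n - l n) * partial_pi a l N n)
      * ((\<Prod>k\<in>{..<N} - {j}. l n - l k) / (\<Prod>k<N. l n - a k))"
    using assms by (simp add: sum_residues_pair)
  also have "\<dots> = of_bool (n = j)"
  proof (cases "n = j")
    case False
    then have "(\<Prod>k\<in>{..<N} - {j}. l n - l k) = 0"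
      using n by auto
    then show ?thesis using False by simp
  next
    case True
    have "(\<Prod>k<N. l n - a k) = (l n - a n) * (\<Prod>k\<in>{..<N} - {n}. l n - a k)"
      using n by (subst prod.remove[of _ n]) auto
    moreover have "(\<Prod>k\<in>{..<N} - {n}. l n - a k) \<noteq> 0"
      using ne by (auto dest: not_sym)
    moreover have "(\<Prod>k\<in>{..<N} - {n}. l n - l k) \<noteq> 0"
      using n inj by (auto simp: inj_on_def)
    moreover have "l n - a n \<noteq> 0"
      using ne[of n n] by simp
    ultimately show ?thesis
      using True nz by (simp add: partial_pi_eq divide_simps)
  qed
  finally show ?thesis .
qed

section \<open>Matrices with exponential off-diagonal decay\<close>

definition mat_op :: "(nat \<Rightarrow> nat \<Rightarrow> complex) \<Rightarrow> cseq \<Rightarrow> cseq" where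
  "mat_op M x = (\<lambda>i. \<Sum>j. M i j * x j)"

text \<open>One of the two truncated differences vanishes, so the exponent is \<open>\<bar>i - j\<bar>\<close>.\<close>

definition offdiag_weight :: "real \<Rightarrow> nat \<Rightarrow> nat \<Rightarrow> real" where
  "offdiag_weight r i j = r ^ ((i - j) + (j - i))"

definition localized :: "real \<Rightarrow> real \<Rightarrow> (nat \<Rightarrow> nat \<Rightarrow> complex) \<Rightarrow> bool" where
  "localized C r M \<longleftrightarrow> 0 < r \<and> r < 1 \<and> (\<forall>i j. norm (M i j) \<le> C * offdiag_weight r i j)"

lemma offdiag_weight_commute: "offdiag_weight r i j = offdiag_weight r j i"
  by (simp add: offdiag_weight_def add.commute)

lemma offdiag_weight_nonneg: "0 < r \<Longrightarrow> 0 \<le> offdiag_weight r i j"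
  by (simp add: offdiag_weight_def)

lemma localized_const_nonneg: "localized C r M \<Longrightarrow> 0 \<le> C"
  unfolding localized_def offdiag_weight_def
  by (metis norm_ge_zero order_trans cancel_comm_monoid_add_class.diff_cancel add_0 power_0 mult.right_neutral)

lemma sum_distinct_powers_le:
  fixes r :: real
  assumes r: "0 < r" "r < 1" and "finite F" and "inj_on f F"
  shows "(\<Sum>j\<in>F. r ^ f j) \<le> 1 / (1 - r)"
proof -
  have "(\<Sum>j\<in>F. r ^ f j) = (\<Sum>d\<in>f ` F. r ^ d)"
    using assms by (simp add: sum.reindex)
  also have "\<dots> \<le> (\<Sum>d. r ^ d)"
    using assms by (intro sum_le_suminf) (auto intro: summable_geometric)
  also have "\<dots> = 1 / (1 - r)"
    using r by (intro suminf_geometric) auto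
  finally show ?thesis .
qed

lemma sum_offdiag_weight_le:
  assumes r: "0 < r" "r < 1" and F: "finite F"
  shows "(\<Sum>j\<in>F. offdiag_weight r i j) \<le> 2 / (1 - r)"
proof -
  have "(\<Sum>j\<in>F. offdiag_weight r i j)
      = (\<Sum>j\<in>F \<inter> {..i}. offdiag_weight r i j) + (\<Sum>j\<in>F - {..i}. offdiag_weight r i j)"
    using F by (rule sum.Int_Diff)
  also have "(\<Sum>j\<in>F \<inter> {..i}. offdiag_weight r i j) = (\<Sum>j\<in>F \<inter> {..i}. r ^ (i - j))"
    by (intro sum.cong) (auto simp: offdiag_weight_def)
  also have "\<dots> \<le> 1 / (1 - r)"
    using r F by (intro sum_distinct_powers_le) (auto simp: inj_on_def)
  also have "(\<Sum>j\<in>F - {..i}. offdiag_weight r i j) = (\<Sum>j\<in>F - {..i}. r ^ (j - i))"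
    by (intro sum.cong) (auto simp: offdiag_weight_def)
  also have "\<dots> \<le> 1 / (1 - r)"
    using r F by (intro sum_distinct_powers_le) (auto simp: inj_on_def)
  finally show ?thesis by simp
qed

lemma summable_offdiag_weight:
  assumes "0 < r" "r < 1"
  shows "summable (\<lambda>j. offdiag_weight r i j)"
  using assms
  by (intro summableI_nonneg_bounded[where x = "2 / (1 - r)"] sum_offdiag_weight_le)
     (auto simp: offdiag_weight_nonneg)

lemma suminf_offdiag_weight_le:
  assumes "0 < r" "r < 1"
  shows "(\<Sum>j. offdiag_weight r i j) \<le> 2 / (1 - r)"
  using assms by (intro suminf_le_const summable_offdiag_weight sum_offdiag_weight_le) auto

lemma localized_nonneg_row_sum:
  fixes t :: "nat \<Rightarrow> real"
  assumes r: "0 < r" "r < 1" and t: "\<And>j. 0 \<le> t j" "\<And>j. t j \<le> B"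
  shows "summable (\<lambda>j. offdiag_weight r i j * t j)"
    and "(\<Sum>j. offdiag_weight r i j * t j) \<le> 2 / (1 - r) * B"
proof -
  have le: "offdiag_weight r i j * t j \<le> offdiag_weight r i j * B" for j
    using r t by (intro mult_left_mono offdiag_weight_nonneg)
  have sB: "summable (\<lambda>j. offdiag_weight r i j * B)"
    by (intro summable_mult2 summable_offdiag_weight r)
  show s: "summable (\<lambda>j. offdiag_weight r i j * t j)"
    using le r t by (intro summable_comparison_test'[OF sB, of 0]) (auto simp: offdiag_weight_nonneg)
  have "(\<Sum>j. offdiag_weight r i j * t j) \<le> (\<Sum>j. offdiag_weight r i j * B)"
    by (intro suminf_le le s sB)
  also have "\<dots> = (\<Sum>j. offdiag_weight r i j) * B"
    by (intro suminf_mult2[symmetric] summable_offdiag_weight r)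
  also have "\<dots> \<le> 2 / (1 - r) * B"
    using order_trans[OF t] by (intro mult_right_mono suminf_offdiag_weight_le r)
  finally show "(\<Sum>j. offdiag_weight r i j * t j) \<le> 2 / (1 - r) * B" .
qed

lemma mat_op_row:
  assumes M: "localized C r M" and x: "\<And>j. norm (x j) \<le> B"
  shows "summable (\<lambda>j. norm (M i j * x j))"
    and "summable (\<lambda>j. M i j * x j)"
    and "norm (mat_op M x i) \<le> C * (\<Sum>j. offdiag_weight r i j * norm (x j))"
proof -
  have r: "0 < r" "r < 1" using M by (auto simp: localized_def)
  have le: "norm (M i j * x j) \<le> C * (offdiag_weight r i j * norm (x j))" for j
    using M mult_right_mono[of "norm (M i j)" "C * offdiag_weight r i j" "norm (x j)"]
    by (simp add: localized_def norm_mult mult.assoc)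
  have sB: "summable (\<lambda>j. C * (offdiag_weight r i j * norm (x j)))"
    using x by (intro summable_mult localized_nonneg_row_sum r) auto
  show s: "summable (\<lambda>j. norm (M i j * x j))"
    using le by (intro summable_comparison_test'[OF sB, of 0]) auto
  then show "summable (\<lambda>j. M i j * x j)"
    by (rule summable_norm_cancel)
  have "norm (mat_op M x i) \<le> (\<Sum>j. norm (M i j * x j))"
    unfolding mat_op_def by (rule summable_norm[OF s])
  also have "\<dots> \<le> (\<Sum>j. C * (offdiag_weight r i j * norm (x j)))"
    by (intro suminf_le le s sB)
  also have "\<dots> = C * (\<Sum>j. offdiag_weight r i j * norm (x j))"
    using x by (intro suminf_mult localized_nonneg_row_sum r) auto
  finally show "norm (mat_op M x i) \<le> C * (\<Sum>j. offdiag_weight r i j * norm (x j))" .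
qed

lemma mat_op_bound:
  assumes M: "localized C r M" and x: "\<And>j. norm (x j) \<le> B"
  shows "norm (mat_op M x i) \<le> C * (2 / (1 - r)) * B"
proof -
  have r: "0 < r" "r < 1" using M by (auto simp: localized_def)
  have "C * (\<Sum>j. offdiag_weight r i j * norm (x j)) \<le> C * (2 / (1 - r) * B)"
    using x M by (intro mult_left_mono localized_nonneg_row_sum r)
      (auto intro: localized_const_nonneg)
  with mat_op_row(3)[where x = x and B = B, OF M x] show ?thesis
    by (simp add: mult.assoc) (meson order_trans)
qed

text \<open>Split the sum at \<open>J\<close>: the entries of a fixed column tend to \<open>0\<close>, and the tail of \<open>x\<close>
  beyond \<open>J\<close> is uniformly small.\<close>

lemma mat_op_tendsto_0:
  assumes M: "localized C r M" and x: "x \<longlonglongrightarrow> 0"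
  shows "mat_op M x \<longlonglongrightarrow> 0"
proof (rule LIMSEQ_I)
  fix e :: real assume e: "0 < e"
  have r: "0 < r" "r < 1" using M by (auto simp: localized_def)
  have C: "0 \<le> C" using M by (rule localized_const_nonneg)
  define K where "K = C * (2 / (1 - r))"
  have K: "0 \<le> K" using C r by (simp add: K_def)
  obtain B where B: "\<And>j. norm (x j) \<le> B"
    using convergent_imp_Bseq[OF convergentI[OF x]] by (auto simp: Bseq_def)
  obtain J where J: "\<And>j. j \<ge> J \<Longrightarrow> norm (x j) < e / (2 * (K + 1))"
    using LIMSEQ_D[OF x, of "e / (2 * (K + 1))"] e K by auto
  define u where "u j = (if j < J then x j else 0)" for j
  define v where "v j = (if j < J then 0 else x j)" for j
  have u: "norm (u j) \<le> B" for j
    using B[of j] order_trans[OF norm_ge_zero B[of j]] by (simp add: u_def)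
  have v: "norm (v j) \<le> e / (2 * (K + 1))" for j
    using J[of j] e K by (auto simp: v_def less_imp_le)
  have split: "mat_op M x i = mat_op M u i + mat_op M v i" for i
  proof -
    have "mat_op M u i + mat_op M v i = (\<Sum>j. M i j * u j + M i j * v j)"
      unfolding mat_op_def
      by (rule suminf_add[OF mat_op_row(2)[OF M u] mat_op_row(2)[OF M v]])
    also have "(\<lambda>j. M i j * u j + M i j * v j) = (\<lambda>j. M i j * x j)"
      by (auto simp: u_def v_def)
    finally show ?thesis by (simp add: mat_op_def)
  qed
  have col: "(\<lambda>i. M i j) \<longlonglongrightarrow> 0" for j
  proof (rule Lim_null_comparison)
    show "\<forall>\<^sub>F i in sequentially. norm (M i j) \<le> C * offdiag_weight r i j"
      using M by (simp add: localized_def)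
    have "(\<lambda>i. offdiag_weight r i j) \<longlonglongrightarrow> 0"
      using summable_LIMSEQ_zero[OF summable_offdiag_weight[OF r, of j]]
      by (simp add: offdiag_weight_commute)
    then show "(\<lambda>i. C * offdiag_weight r i j) \<longlonglongrightarrow> 0"
      by (rule tendsto_mult_right_zero)
  qed
  have "mat_op M u = (\<lambda>i. \<Sum>j<J. M i j * x j)"
    unfolding mat_op_def by (rule ext, subst suminf_finite[of "{..<J}"]) (auto simp: u_def)
  moreover have "(\<lambda>i. \<Sum>j<J. M i j * x j) \<longlonglongrightarrow> (\<Sum>j<J. 0 * x j)"
    by (intro tendsto_intros col)
  ultimately have "mat_op M u \<longlonglongrightarrow> 0"
    by simp
  then obtain I where I: "\<And>i. i \<ge> I \<Longrightarrow> norm (mat_op M u i) < e / 2"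
    using LIMSEQ_D[of "mat_op M u" 0 "e / 2"] e by auto
  \<comment> \<open>The bound \<open>e / (2 * (K + 1))\<close> for the tail makes sense even when \<open>K = 0\<close>.\<close>
  have tail: "norm (mat_op M v i) \<le> e / 2" for i
  proof -
    have "norm (mat_op M v i) \<le> K * (e / (2 * (K + 1)))"
      unfolding K_def by (rule mat_op_bound[OF M]) (use v in \<open>simp add: K_def\<close>)
    also have "\<dots> = e / 2 * (K / (K + 1))"
      by (simp add: field_simps)
    also have "\<dots> \<le> e / 2 * 1"
      using e K by (intro mult_left_mono) auto
    finally show ?thesis by simp
  qed
  show "\<exists>no. \<forall>i\<ge>no. norm (mat_op M x i - 0) < e"
  proof (intro exI allI impI)
    fix i assume "I \<le> i"
    then have "norm (mat_op M u i) + norm (mat_op M v i) < e / 2 + e / 2"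
      using I tail by (intro add_less_le_mono)
    then show "norm (mat_op M x i - 0) < e"
      using norm_triangle_ineq[of "mat_op M u i" "mat_op M v i"] by (simp add: split)
  qed
qed

lemma powr_above_tangent:
  fixes s u p :: real
  assumes p: "1 \<le> p" and "0 \<le> s" "0 \<le> u"
  shows "u powr p + p * u powr (p - 1) * (s - u) \<le> s powr p"
proof (cases "u = 0 \<or> s = 0")
  case True
  have "u * u powr (p - 1) = u powr p" if "u \<noteq> 0"
    using that assms by (simp add: powr_mult_base)
  moreover have "u powr p \<le> p * u powr p"
    using p mult_right_mono[of 1 p "u powr p"] by simp
  ultimately show ?thesis
    using True by (cases "u = 0") (auto simp: mult.assoc mult.commute[of u])
next
  case False
  then have pos: "0 < u" "0 < s" using assms by auto
  have "s powr p - u powr p \<ge> p * u powr (p - 1) * (s - u)"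
    using pos p
    by (intro convex_on_imp_above_tangent[where A = "{0<..}"] powr_convex)
       (auto simp: interior_open intro!: derivative_eq_intros)
  then show ?thesis by simp
qed

text \<open>Jensen's inequality for the weights \<open>w\<close> of total mass at most \<open>S\<close>: integrate the tangent
  inequality at the point \<open>u = (\<Sum>j. w j * t j) / S\<close>.\<close>

lemma weighted_power_mean:
  fixes w t :: "nat \<Rightarrow> real"
  assumes p: "1 \<le> p" and S: "0 < S" and w: "\<And>j. 0 \<le> w j" "summable w" "suminf w \<le> S"
    and t: "\<And>j. 0 \<le> t j" and st: "summable (\<lambda>j. w j * t j)"
    and sp: "summable (\<lambda>j. w j * t j powr p)"
  shows "(\<Sum>j. w j * t j) powr p \<le> S powr p / S * (\<Sum>j. w j * t j powr p)"
proof -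
  define u where "u = (\<Sum>j. w j * t j) / S"
  have u0: "0 \<le> u"
    unfolding u_def using w t st S by (intro divide_nonneg_pos suminf_nonneg) auto
  define d where "d = p * u powr (p - 1)"
  have sum_u: "(\<Sum>j. w j * t j) = S * u"
    using S by (simp add: u_def)
  have "u powr p * S \<le> u powr p * suminf w + d * (S * u - u * suminf w)"
  proof -
    have *: "d * u = p * u powr p"
      using u0 by (cases "u = 0") (auto simp: d_def powr_mult_base mult.assoc mult.commute[of _ u])
    have "u powr p * suminf w + d * (S * u - u * suminf w) - u powr p * S
        = (d * u - u powr p) * (S - suminf w)"
      by (simp add: algebra_simps)
    also have "\<dots> = (p - 1) * u powr p * (S - suminf w)"
      unfolding * by (simp add: algebra_simps)
    also have "\<dots> \<ge> 0"
      using p w by auto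
    finally show ?thesis by simp
  qed
  also have "\<dots> = (\<Sum>j. u powr p * w j + d * (w j * t j - u * w j))"
  proof -
    have 1: "summable (\<lambda>j. u powr p * w j)" "summable (\<lambda>j. u * w j)"
      using w by (auto intro: summable_mult)
    have 2: "summable (\<lambda>j. w j * t j - u * w j)"
      using 1 st by (intro summable_diff)
    show ?thesis
      using 1 2 w st
      by (simp add: suminf_add[symmetric] suminf_mult suminf_diff[symmetric] sum_u summable_mult)
  qed
  also have "\<dots> \<le> (\<Sum>j. w j * t j powr p)"
  proof (rule suminf_le[OF _ _ sp])
    fix j
    have "w j * (u powr p + d * (t j - u)) \<le> w j * t j powr p"
      unfolding d_def using w t u0 p by (intro mult_left_mono powr_above_tangent) auto
    then show "u powr p * w j + d * (w j * t j - u * w j) \<le> w j * t j powr p"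
      by (simp add: algebra_simps)
  next
    show "summable (\<lambda>j. u powr p * w j + d * (w j * t j - u * w j))"
      using w st by (intro summable_add summable_mult summable_diff)
  qed
  finally have "S powr p / S * (u powr p * S) \<le> S powr p / S * (\<Sum>j. w j * t j powr p)"
    using S by (intro mult_left_mono) auto
  moreover have "S powr p / S * (u powr p * S) = (\<Sum>j. w j * t j) powr p"
    using S u0 by (simp add: sum_u powr_mult)
  ultimately show ?thesis by simp
qed

lemma norm_le_of_summable_powr:
  fixes x :: cseq
  assumes p: "1 \<le> p" and x: "summable (\<lambda>n. norm (x n) powr p)"
  shows "norm (x n) \<le> (\<Sum>n. norm (x n) powr p) powr (1 / p)"
proof -
  have "norm (x n) powr p \<le> (\<Sum>n. norm (x n) powr p)"
    using sum_le_suminf[OF x, of "{n}"] by simp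
  then have "(norm (x n) powr p) powr (1 / p) \<le> (\<Sum>n. norm (x n) powr p) powr (1 / p)"
    using p by (intro powr_mono2) auto
  then show ?thesis
    using p by (simp add: powr_powr)
qed

text \<open>Schur's test: the row sums of the weights enter through Jensen's inequality, the column
  sums through interchanging the order of summation.\<close>

lemma mat_op_summable_powr:
  assumes p: "1 \<le> p" and M: "localized C r M" and x: "summable (\<lambda>n. norm (x n) powr p)"
  shows "summable (\<lambda>n. norm (mat_op M x n) powr p)"
    and "(\<Sum>n. norm (mat_op M x n) powr p) \<le> (C * (2 / (1 - r))) powr p * (\<Sum>n. norm (x n) powr p)"
proof -
  have r: "0 < r" "r < 1" using M by (auto simp: localized_def)
  have C: "0 \<le> C" using M by (rule localized_const_nonneg)
  define S where "S = 2 / (1 - r)"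
  have S: "0 < S" using r by (simp add: S_def)
  define t where "t j = norm (x j)" for j
  obtain B where B: "\<And>j. t j \<le> B"
    unfolding t_def using norm_le_of_summable_powr[OF p x] by blast
  have tp: "t j powr p \<le> B powr p" for j
    using B p by (intro powr_mono2) (auto simp: t_def)
  have st: "summable (\<lambda>j. offdiag_weight r i j * t j)" for i
    using B by (intro localized_nonneg_row_sum r) (auto simp: t_def)
  have sp: "summable (\<lambda>j. offdiag_weight r i j * t j powr p)" for i
    using tp by (intro localized_nonneg_row_sum r) auto
  have row: "norm (mat_op M x i) powr p
      \<le> C powr p * (S powr p / S) * (\<Sum>j. offdiag_weight r i j * t j powr p)" for i
  proof -
    have "norm (mat_op M x i) powr p \<le> (C * (\<Sum>j. offdiag_weight r i j * t j)) powr p"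
      using mat_op_row(3)[OF M, of x B] B p by (intro powr_mono2) (auto simp: t_def)
    also have "\<dots> = C powr p * (\<Sum>j. offdiag_weight r i j * t j) powr p"
      by (rule powr_mult)
    also have "\<dots> \<le> C powr p * (S powr p / S * (\<Sum>j. offdiag_weight r i j * t j powr p))"
      using r st sp S
      by (intro mult_left_mono weighted_power_mean[OF p])
         (auto simp: t_def offdiag_weight_nonneg S_def intro: summable_offdiag_weight suminf_offdiag_weight_le)
    finally show ?thesis by (simp add: mult.assoc)
  qed
  have xp: "summable (\<lambda>j. t j powr p)" using x by (simp add: t_def)
  have bound: "(\<Sum>i<N. norm (mat_op M x i) powr p) \<le> (C * S) powr p * (\<Sum>j. t j powr p)" for N
  proof -
    have "(\<Sum>i<N. norm (mat_op M x i) powr p)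
        \<le> (\<Sum>i<N. C powr p * (S powr p / S) * (\<Sum>j. offdiag_weight r i j * t j powr p))"
      by (intro sum_mono row)
    also have "\<dots> = C powr p * (S powr p / S) * (\<Sum>i<N. \<Sum>j. offdiag_weight r i j * t j powr p)"
      by (simp add: sum_distrib_left)
    also have "\<dots> \<le> C powr p * (S powr p / S) * (S * (\<Sum>j. t j powr p))"
    proof (rule mult_left_mono)
      have "(\<Sum>i<N. \<Sum>j. offdiag_weight r i j * t j powr p)
          = (\<Sum>j. \<Sum>i<N. offdiag_weight r i j * t j powr p)"
        by (intro suminf_sum[symmetric] sp)
      also have "\<dots> \<le> (\<Sum>j. S * t j powr p)"
      proof (rule suminf_le)
        fix j
        have "(\<Sum>i<N. offdiag_weight r i j) \<le> S"
          using sum_offdiag_weight_le[OF r, of "{..<N}" j]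
          by (simp add: S_def offdiag_weight_commute)
        then show "(\<Sum>i<N. offdiag_weight r i j * t j powr p) \<le> S * t j powr p"
          by (simp add: sum_distrib_right[symmetric] mult_right_mono)
      qed (use sp xp in \<open>auto intro: summable_sum summable_mult\<close>)
      also have "\<dots> = S * (\<Sum>j. t j powr p)"
        using xp by (rule suminf_mult)
      finally show "(\<Sum>i<N. \<Sum>j. offdiag_weight r i j * t j powr p) \<le> S * (\<Sum>j. t j powr p)" .
    qed (use S in simp)
    also have "\<dots> = (C * S) powr p * (\<Sum>j. t j powr p)"
      using S by (simp add: powr_mult)
    finally show ?thesis .
  qed
  show s: "summable (\<lambda>n. norm (mat_op M x n) powr p)"
    using bound by (intro summableI_nonneg_bounded) auto
  show "(\<Sum>n. norm (mat_op M x n) powr p) \<le> (C * (2 / (1 - r))) powr p * (\<Sum>n. norm (x n) powr p)"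
    using suminf_le_const[OF s bound] by (simp add: S_def t_def)
qed

section \<open>Sequence spaces\<close>

definition lp_space :: "real \<Rightarrow> seq_space" where
  "lp_space q = \<lparr>seqs = {x. summable (\<lambda>n. norm (x n) powr q)},
     seq_norm = (\<lambda>x. (\<Sum>n. norm (x n) powr q) powr (1 / q))\<rparr>"

definition linf_space :: seq_space where
  "linf_space = \<lparr>seqs = {x. bounded (range x)}, seq_norm = sup_norm\<rparr>"

lemma ell_cases:
  assumes "1 \<le> p"
  obtains "ell p = linf_space" | q where "1 \<le> q" "ell p = lp_space q"
proof (cases "p = \<infinity>")
  case True
  then show ?thesis using that(1) by (simp add: ell_def linf_space_def)
next
  case False
  then have "enn2real 1 \<le> enn2real p"
    using assms by (intro enn2real_mono) (auto simp: top.not_eq_extremum)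
  then show ?thesis using that(2) False by (simp add: ell_def lp_space_def)
qed

lemma ell_c0_cases:
  assumes "X \<in> {ell p |p. 1 \<le> p} \<union> {c0_space}"
  obtains "X = linf_space" | "X = c0_space" | q where "1 \<le> q" "X = lp_space q"
  using assms by (auto elim!: ell_cases)

lemma norm_le_sup_norm:
  assumes "bounded (range x)"
  shows "norm (x n) \<le> sup_norm x"
proof -
  obtain B where "norm (x m) \<le> B" for m
    using assms unfolding bounded_iff by blast
  then show ?thesis
    unfolding sup_norm_def by (intro cSUP_upper bdd_aboveI2[of _ _ B]) auto
qed

lemma sup_norm_le: "(\<And>n. norm (x n) \<le> B) \<Longrightarrow> sup_norm x \<le> B"
  unfolding sup_norm_def by (rule cSUP_least) auto

lemma norm_le_seq_norm:
  assumes X: "X \<in> {ell p |p. 1 \<le> p} \<union> {c_space, c0_space}" and x: "x \<in> seqs X"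
  shows "norm (x n) \<le> seq_norm X x"
proof -
  have *: "norm (x n) \<le> sup_norm x" if "convergent x"
    using that by (intro norm_le_sup_norm) (auto intro: convergent_imp_bounded simp: convergent_def)
  consider "X = c_space" | "X = linf_space" | "X = c0_space" | q where "1 \<le> q" "X = lp_space q"
    using X by (auto elim!: ell_cases)
  then show ?thesis
  proof cases
    case 1
    then show ?thesis using x * by (simp add: c_space_def)
  next
    case 2
    then show ?thesis using x norm_le_sup_norm by (simp add: linf_space_def)
  next
    case 3
    then show ?thesis using x * by (auto simp: c0_space_def convergent_def)
  next
    case 4
    then show ?thesis using x norm_le_of_summable_powr by (simp add: lp_space_def)
  qed
qed

lemma mat_op_in_space:
  assumes X: "X \<in> {ell p |p. 1 \<le> p} \<union> {c0_space}" and M: "localized C r M" and x: "x \<in> seqs X"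
  shows "mat_op M x \<in> seqs X" and "seq_norm X (mat_op M x) \<le> C * (2 / (1 - r)) * seq_norm X x"
proof -
  define K where "K = C * (2 / (1 - r))"
  have K: "0 \<le> K"
    using localized_const_nonneg[OF M] M by (auto simp: K_def localized_def)
  have le: "norm (mat_op M x n) \<le> K * seq_norm X x" for n
    unfolding K_def using X x by (intro mat_op_bound[OF M] norm_le_seq_norm) auto
  have "mat_op M x \<in> seqs X \<and> seq_norm X (mat_op M x) \<le> K * seq_norm X x"
    using X
  proof (cases rule: ell_c0_cases)
    case 1
    have "bounded (range (mat_op M x))"
      using le by (auto simp: bounded_iff)
    then show ?thesis
      using le sup_norm_le[of "mat_op M x"] by (simp add: 1 linf_space_def)
  next
    case 2
    then show ?thesis
      using le x mat_op_tendsto_0[OF M] sup_norm_le[of "mat_op M x"] by (simp add: c0_space_def)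
  next
    case (3 q)
    then have xq: "summable (\<lambda>n. norm (x n) powr q)"
      using x by (simp add: lp_space_def)
    have "(\<Sum>n. norm (mat_op M x n) powr q) powr (1 / q)
        \<le> (K powr q * (\<Sum>n. norm (x n) powr q)) powr (1 / q)"
      using 3 mat_op_summable_powr[OF _ M xq, folded K_def]
      by (intro powr_mono2) (auto intro!: suminf_nonneg)
    also have "\<dots> = K * (\<Sum>n. norm (x n) powr q) powr (1 / q)"
      using K 3 by (simp add: powr_mult powr_powr)
    finally show ?thesis
      using 3 mat_op_summable_powr(1)[OF _ M xq] by (simp add: lp_space_def)
  qed
  then show "mat_op M x \<in> seqs X" "seq_norm X (mat_op M x) \<le> C * (2 / (1 - r)) * seq_norm X x"
    by (auto simp: K_def)
qed

lemma bounded_op_mat_op: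
  assumes X: "X \<in> {ell p |p. 1 \<le> p} \<union> {c0_space}" and M: "localized C r M"
  shows "bounded_op X (mat_op M)"
proof -
  have s: "summable (\<lambda>j. M i j * x j)" if "x \<in> seqs X" for x i
    using X that by (intro mat_op_row(2)[OF M, of _ "seq_norm X x"] norm_le_seq_norm) auto
  have "mat_op M (\<lambda>n. x n + y n) = (\<lambda>n. mat_op M x n + mat_op M y n)"
    if "x \<in> seqs X" "y \<in> seqs X" for x y
    using suminf_add[OF s[OF that(1)] s[OF that(2)]] by (simp add: mat_op_def distrib_left)
  moreover have "mat_op M (\<lambda>n. z * x n) = (\<lambda>n. z * mat_op M x n)" if "x \<in> seqs X" for x z
    using suminf_mult[OF s[OF that], of z] by (simp add: mat_op_def mult.left_commute)
  ultimately show ?thesis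
    unfolding bounded_op_def using mat_op_in_space[OF X M] by blast
qed

text \<open>A diagonal matrix is localized for every \<open>r\<close>; the proof takes \<open>1 / 2\<close>.\<close>

lemma bounded_op_diag_op:
  assumes X: "X \<in> {ell p |p. 1 \<le> p} \<union> {c0_space}" and mu: "\<And>n. norm (\<mu> n) \<le> B"
  shows "bounded_op X (diag_op \<mu>)"
proof -
  define D where "D i j = (if i = j then \<mu> i else 0)" for i j :: nat
  have "0 \<le> B" using order_trans[OF norm_ge_zero mu] .
  then have "localized B (1 / 2) D"
    using mu by (auto simp: localized_def D_def offdiag_weight_def)
  moreover have "mat_op D x = diag_op \<mu> x" for x
  proof
    fix i
    have "(\<Sum>j. D i j * x j) = (\<Sum>j\<in>{i}. D i j * x j)"
      by (rule suminf_finite) (auto simp: D_def)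
    then show "mat_op D x i = diag_op \<mu> x i"
      by (simp add: mat_op_def diag_op_def D_def)
  qed
  then have "mat_op D = diag_op \<mu>" by auto
  ultimately show ?thesis
    using bounded_op_mat_op[OF X] by metis
qed

lemma add_in_space:
  assumes X: "X \<in> {ell p |p. 1 \<le> p} \<union> {c0_space}" and xy: "x \<in> seqs X" "y \<in> seqs X"
  shows "(\<lambda>n. x n + y n) \<in> seqs X"
  using X
proof (cases rule: ell_c0_cases)
  case 1
  have "norm (x n + y n) \<le> seq_norm X x + seq_norm X y" for n
    using X xy by (intro order_trans[OF norm_triangle_ineq] add_mono norm_le_seq_norm) auto
  then show ?thesis by (auto simp: 1 linf_space_def bounded_iff)
next
  case 2
  then show ?thesis using xy by (auto simp: c0_space_def intro: tendsto_add_zero)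
next
  case (3 q)
  have "norm (norm (x n + y n) powr q)
      \<le> 2 powr q * norm (x n) powr q + 2 powr q * norm (y n) powr q" for n
  proof -
    have "norm (x n + y n) \<le> 2 * max (norm (x n)) (norm (y n))"
      using norm_triangle_ineq[of "x n" "y n"] by linarith
    then have "norm (x n + y n) powr q \<le> (2 * max (norm (x n)) (norm (y n))) powr q"
      using 3 by (intro powr_mono2) auto
    also have "\<dots> = 2 powr q * (max (norm (x n)) (norm (y n))) powr q"
      by (simp add: powr_mult)
    also have "\<dots> \<le> 2 powr q * norm (x n) powr q + 2 powr q * norm (y n) powr q"
      by (auto simp: max_def)
    finally show ?thesis by simp
  qed
  moreover have "summable (\<lambda>n. 2 powr q * norm (x n) powr q + 2 powr q * norm (y n) powr q)"
    using xy 3 by (intro summable_add summable_mult) (auto simp: lp_space_def)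
  ultimately have "summable (\<lambda>n. norm (x n + y n) powr q)"
    by (rule summable_comparison_test'[where N = 0, rotated])
  then show ?thesis by (simp add: 3 lp_space_def)
qed

definition unit_seq :: "nat \<Rightarrow> cseq" where
  "unit_seq n = (\<lambda>m. of_bool (m = n))"

lemma unit_seq_in_space:
  assumes "X \<in> {ell p |p. 1 \<le> p} \<union> {c0_space}"
  shows "unit_seq n \<in> seqs X"
  using assms
proof (cases rule: ell_c0_cases)
  case 1
  have "norm (unit_seq n m) \<le> 1" for m by (simp add: unit_seq_def)
  then show ?thesis
    unfolding 1 linf_space_def by (auto simp: bounded_iff)
next
  case 2
  have "(\<lambda>m. of_bool (m = n) :: complex) \<longlonglongrightarrow> 0"
    by (rule tendsto_eventually) (auto intro!: eventually_sequentiallyI[of "Suc n"])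
  then show ?thesis by (simp add: 2 c0_space_def unit_seq_def)
next
  case (3 q)
  have "summable (\<lambda>m. norm (unit_seq n m) powr q)"
    by (rule summable_finite[of "{n}"]) (auto simp: unit_seq_def)
  then show ?thesis by (simp add: 3 lp_space_def)
qed

lemma bounded_op_comp:
  assumes X: "X \<in> {ell p |p. 1 \<le> p} \<union> {c0_space}"
    and S: "bounded_op X S" and T: "bounded_op X T"
  shows "bounded_op X (\<lambda>x. S (T x))"
proof -
  obtain c where c: "\<And>x. x \<in> seqs X \<Longrightarrow> seq_norm X (S x) \<le> c * seq_norm X x"
    using S unfolding bounded_op_def by blast
  obtain d where d: "\<And>x. x \<in> seqs X \<Longrightarrow> seq_norm X (T x) \<le> d * seq_norm X x"
    using T unfolding bounded_op_def by blast
  have "seq_norm X (S (T x)) \<le> (\<bar>c\<bar> * d) * seq_norm X x" if x: "x \<in> seqs X" for x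
  proof -
    have Tx: "T x \<in> seqs X" using T x by (auto simp: bounded_op_def)
    have "0 \<le> seq_norm X (T x)"
      using X Tx by (intro order_trans[OF norm_ge_zero norm_le_seq_norm[of X _ 0]]) auto
    then have "c * seq_norm X (T x) \<le> \<bar>c\<bar> * seq_norm X (T x)"
      by (intro mult_right_mono) auto
    also have "\<dots> \<le> \<bar>c\<bar> * (d * seq_norm X x)"
      using d[OF x] by (intro mult_left_mono) auto
    finally show ?thesis using c[OF Tx] by simp
  qed
  then have "\<exists>e. \<forall>x\<in>seqs X. seq_norm X (S (T x)) \<le> e * seq_norm X x"
    by blast
  then show ?thesis
    using S T by (simp add: bounded_op_def)
qed

lemma summable_in_dual:
  assumes X: "X \<in> {ell p |p. 1 \<le> p} \<union> {c_space, c0_space}" and k: "summable (\<lambda>n. norm (k n))"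
  shows "k \<in> seq_dual X"
proof -
  have le: "norm (k n * x n) \<le> norm (k n) * seq_norm X x" if "x \<in> seqs X" for x n
    using that X by (simp add: norm_mult mult_left_mono norm_le_seq_norm)
  have sB: "summable (\<lambda>n. norm (k n) * B)" for B
    using k by (rule summable_mult2)
  have s: "summable (\<lambda>n. norm (k n * x n))" if "x \<in> seqs X" for x
    using le[OF that] by (intro summable_comparison_test'[OF sB, of 0]) auto
  have "norm (seq_functional k x) \<le> (\<Sum>n. norm (k n)) * seq_norm X x" if "x \<in> seqs X" for x
  proof -
    have "norm (seq_functional k x) \<le> (\<Sum>n. norm (k n * x n))"
      unfolding seq_functional_def by (rule summable_norm[OF s[OF that]])
    also have "\<dots> \<le> (\<Sum>n. norm (k n) * seq_norm X x)"
      by (intro suminf_le le that s sB)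
    also have "\<dots> = (\<Sum>n. norm (k n)) * seq_norm X x"
      by (rule suminf_mult2[symmetric, OF k])
    finally show ?thesis .
  qed
  then show ?thesis
    using summable_norm_cancel[OF s] by (auto simp: seq_dual_def)
qed

section \<open>The infinite products\<close>

lemma partial_pi_minus: "partial_pi (\<lambda>n. - x n) (\<lambda>n. - y n) N n = partial_pi x y N n"
  by (simp add: partial_pi_def)

text \<open>Both families of products in the inverse of the Cauchy matrix have the form treated here,
  with \<open>(x, y)\<close> equal to \<open>(\<bar>l\<bar>, a)\<close> for \<open>\<pi>(l, a)\<close> and to \<open>(a, \<bar>l\<bar>)\<close> for \<open>\<pi>(a, l)\<close>.\<close>

locale comparable_decay =
  fixes x y e :: "nat \<Rightarrow> real" and r :: real
  assumes r: "0 < r" "r < 1" and x_nonneg: "\<And>n. 0 \<le> x n" and y_pos: "\<And>n. 0 < y n"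
    and y_decay: "\<And>n m. n \<le> m \<Longrightarrow> y m \<le> r ^ (m - n) * y n"
    and e_nonneg: "\<And>n. 0 \<le> e n" and e_summable: "summable e"
    and x_le: "\<And>n. x n \<le> (1 + e n) * y n"
begin

lemma e_le_suminf: "e n \<le> suminf e"
  using sum_le_suminf[OF e_summable, of "{n}"] e_nonneg by simp

lemma weight_le_r: "m \<noteq> n \<Longrightarrow> offdiag_weight r n m \<le> r"
  using power_decreasing[of 1 "(n - m) + (m - n)" r] r by (simp add: offdiag_weight_def)

text \<open>Decay with constant \<open>1\<close> keeps the entries of \<open>y\<close> apart, relative to the larger of the two.\<close>

lemma y_dist:
  assumes "m \<noteq> n"
  shows "(1 - offdiag_weight r n m) * max (y m) (y n) \<le> \<bar>y n - y m\<bar>"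
    and "min (y m) (y n) \<le> offdiag_weight r n m * max (y m) (y n)"
proof -
  have le1: "y j \<le> y i" if "i \<le> j" for i j
  proof -
    have "r ^ (j - i) * y i \<le> 1 * y i"
      using r y_pos[of i] by (intro mult_right_mono power_le_one) auto
    then show ?thesis using y_decay[OF that] by simp
  qed
  have "min (y m) (y n) \<le> offdiag_weight r n m * max (y m) (y n)"
  proof (cases "m \<le> n")
    case True
    then show ?thesis
      using y_decay[OF True] le1[OF True] by (auto simp: offdiag_weight_def max_def min_def)
  next
    case False
    then show ?thesis
      using y_decay[of n m] le1[of n m] by (auto simp: offdiag_weight_def max_def min_def)
  qed
  then show "min (y m) (y n) \<le> offdiag_weight r n m * max (y m) (y n)" .
  then show "(1 - offdiag_weight r n m) * max (y m) (y n) \<le> \<bar>y n - y m\<bar>"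
    by (auto simp: max_def min_def left_diff_distrib split: if_splits)
qed

text \<open>With \<open>s = r ^ \<bar>m - n\<bar>\<close>, the larger of \<open>y m\<close> and \<open>y n\<close> dominates the other by the factor
  \<open>1 / s\<close>. A factor with \<open>m > n\<close> is then \<open>1 + O(s)\<close>. One with \<open>m < n\<close> is close to the ratio
  \<open>x m / y m\<close>, which exceeds \<open>1\<close> by at most \<open>e m\<close>; this is where summability of \<open>e\<close> is needed.\<close>

lemma factor_le:
  assumes "m \<noteq> n"
  shows "(y n + x m) / \<bar>y n - y m\<bar>
    \<le> exp (e m + (1 + suminf e + 1 / (1 - r)) * offdiag_weight r n m)"
proof -
  define s where "s = offdiag_weight r n m"
  define \<Omega> where "\<Omega> = 1 + suminf e"
  have s: "0 < s" "s \<le> r"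
    using r weight_le_r[OF assms] by (auto simp: s_def offdiag_weight_def)
  have \<Omega>: "1 \<le> \<Omega>" "1 + e m \<le> \<Omega>"
    using e_nonneg[of m] e_le_suminf[of m] by (auto simp: \<Omega>_def)
  define z where "z = max (y m) (y n)"
  have z: "0 < z" using y_pos[of m] by (simp add: z_def)
  have den: "(1 - s) * z \<le> \<bar>y n - y m\<bar>"
    using y_dist(1)[OF assms] by (simp add: s_def z_def)
  have num: "y n + x m \<le> (1 + e m) * (1 + \<Omega> * s) * z"
  proof (cases "y m \<le> y n")
    case True
    have "y m \<le> s * z" and [simp]: "z = y n"
      using y_dist(2)[OF assms] True by (auto simp: s_def z_def min_def max_def)
    then have "x m \<le> \<Omega> * (s * z)"
      using x_le[of m] \<Omega> y_pos[of m] by (intro order_trans[OF x_le] mult_mono) auto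
    then have "y n + x m \<le> 1 * (1 + \<Omega> * s) * z"
      by (simp add: algebra_simps)
    also have "\<dots> \<le> (1 + e m) * (1 + \<Omega> * s) * z"
      using e_nonneg[of m] z s \<Omega> by (intro mult_right_mono) auto
    finally show ?thesis .
  next
    case False
    have "y n \<le> s * z" and [simp]: "z = y m"
      using y_dist(2)[OF assms] False by (auto simp: s_def z_def min_def max_def)
    then have "y n + x m \<le> s * z + (1 + e m) * z"
      using x_le[of m] by simp
    also have "\<dots> \<le> (1 + e m) * (\<Omega> * s) * z + (1 + e m) * z"
    proof -
      have "1 * (1 * s) * z \<le> (1 + e m) * (\<Omega> * s) * z"
        using e_nonneg[of m] \<Omega> s z by (intro mult_right_mono mult_mono) auto
      then show ?thesis by linarith
    qed
    finally show ?thesis by (simp add: algebra_simps)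
  qed
  have "0 < 1 - s" using s r by simp
  have "(y n + x m) / \<bar>y n - y m\<bar> \<le> ((1 + e m) * (1 + \<Omega> * s) * z) / ((1 - s) * z)"
    using num den z s r e_nonneg[of m] \<Omega> by (intro frac_le) auto
  also have "\<dots> = (1 + e m) * (1 + \<Omega> * s) * (1 / (1 - s))"
    using z by simp
  also have "\<dots> \<le> exp (e m) * exp (\<Omega> * s) * exp (s / (1 - r))"
  proof (intro mult_mono exp_ge_add_one_self)
    have "1 / (1 - s) = 1 + s / (1 - s)"
      using \<open>0 < 1 - s\<close> by (simp add: field_simps)
    also have "\<dots> \<le> 1 + s / (1 - r)"
      using s r by (intro add_left_mono divide_left_mono mult_pos_pos) auto
    finally show "1 / (1 - s) \<le> exp (s / (1 - r))"
      using exp_ge_add_one_self[of "s / (1 - r)"] by linarith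
  qed (use \<Omega> s r e_nonneg in auto)
  also have "\<dots> = exp (e m + (\<Omega> + 1 / (1 - r)) * s)"
    by (simp add: exp_add[symmetric] algebra_simps)
  finally show ?thesis by (simp add: s_def \<Omega>_def)
qed

lemma norm_factor:
  "norm ((1 - (- complex_of_real (x m)) / of_real (y n)) / (1 - of_real (y m) / of_real (y n)))
    = (y n + x m) / \<bar>y n - y m\<bar>"
proof -
  have "(1 - (- complex_of_real (x m)) / of_real (y n)) / (1 - of_real (y m) / of_real (y n))
      = of_real ((1 + x m / y n) / (1 - y m / y n))"
    by simp
  also have "norm \<dots> = \<bar>(1 + x m / y n) / (1 - y m / y n)\<bar>"
    by (rule norm_of_real)
  also have "(1 + x m / y n) / (1 - y m / y n) = (y n + x m) / (y n - y m)"
    using y_pos[of n] by (cases "y n = y m") (auto simp: divide_simps)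
  also have "\<bar>\<dots>\<bar> = (y n + x m) / \<bar>y n - y m\<bar>"
    using y_pos[of n] x_nonneg[of m] by simp
  finally show ?thesis .
qed

definition pi_bound :: real where
  "pi_bound = exp (suminf e + (1 + suminf e + 1 / (1 - r)) * (2 / (1 - r)))"

lemma pi_bound_pos: "0 < pi_bound"
  by (simp add: pi_bound_def)

lemma norm_partial_pi_le:
  "norm (partial_pi (\<lambda>m. - complex_of_real (x m)) (\<lambda>m. of_real (y m)) N n) \<le> pi_bound"
proof -
  define k where "k = 1 + suminf e + 1 / (1 - r)"
  have k: "0 \<le> k"
    using r e_le_suminf[of 0] e_nonneg[of 0] by (simp add: k_def)
  have "norm (partial_pi (\<lambda>m. - complex_of_real (x m)) (\<lambda>m. of_real (y m)) N n)
      = (\<Prod>m\<in>{..<N} - {n}. (y n + x m) / \<bar>y n - y m\<bar>)"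
    by (simp only: partial_pi_def prod_norm[symmetric] norm_factor)
  also have "\<dots> \<le> (\<Prod>m\<in>{..<N} - {n}. exp (e m + k * offdiag_weight r n m))"
    using factor_le x_nonneg y_pos unfolding k_def
    by (intro prod_mono) (auto intro!: divide_nonneg_nonneg add_nonneg_nonneg simp: less_imp_le)
  also have "\<dots> = exp (\<Sum>m\<in>{..<N} - {n}. e m + k * offdiag_weight r n m)"
    by (simp add: exp_sum)
  also have "\<dots> \<le> pi_bound"
  proof -
    have "(\<Sum>m\<in>{..<N} - {n}. e m) \<le> suminf e"
      using e_nonneg by (intro sum_le_suminf e_summable) auto
    moreover have "k * (\<Sum>m\<in>{..<N} - {n}. offdiag_weight r n m) \<le> k * (2 / (1 - r))"
      using k r by (intro mult_left_mono sum_offdiag_weight_le) auto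
    ultimately show ?thesis
      by (simp add: pi_bound_def k_def[symmetric] sum.distrib sum_distrib_left)
  qed
  finally show ?thesis .
qed

lemma partial_pi_tendsto:
  "(\<lambda>N. partial_pi (\<lambda>m. - complex_of_real (x m)) (\<lambda>m. of_real (y m)) N n)
    \<longlonglongrightarrow> pi_seq (\<lambda>m. - of_real (x m)) (\<lambda>m. of_real (y m)) n"
proof -
  \<comment> \<open>Filling the omitted place \<open>n\<close> with the factor \<open>1\<close> gives an ordinary infinite product.\<close>
  define t where "t m = (if m = n then 1 else
      (1 - (- complex_of_real (x m)) / of_real (y n)) / (1 - of_real (y m) / of_real (y n)))" for m
  have le: "norm (norm (t m - 1)) \<le> (2 + suminf e) / (1 - r) * offdiag_weight r n m"
    if m: "m \<ge> Suc n" for m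
  proof -
    define s where "s = offdiag_weight r n m"
    have s: "0 < s" "s \<le> r"
      using r weight_le_r[of m n] m by (auto simp: s_def offdiag_weight_def)
    have ym: "y m \<le> s * y n"
      using y_decay[of n m] m by (simp add: s_def offdiag_weight_def)
    moreover have "s * y n \<le> r * y n"
      using s y_pos[of n] by (intro mult_right_mono) auto
    ultimately have den: "(1 - r) * y n \<le> y n - y m"
      by (simp add: algebra_simps)
    have pos: "0 < (1 - r) * y n" using r y_pos[of n] by simp
    have "complex_of_real (y n) \<noteq> of_real (y m)"
      using pos den by auto
    then have "t m - 1 = of_real ((x m + y m) / (y n - y m))"
      using y_pos[of n] m by (simp add: t_def divide_simps)
    then have "norm (t m - 1) = (x m + y m) / (y n - y m)"
      using pos den x_nonneg[of m] y_pos[of m] by (simp only: norm_of_real) simp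
    also have "\<dots> \<le> ((2 + suminf e) * (s * y n)) / ((1 - r) * y n)"
    proof (rule frac_le[OF _ _ pos den])
      have "x m + y m \<le> (2 + e m) * y m"
        using x_le[of m] by (simp add: algebra_simps)
      also have "\<dots> \<le> (2 + suminf e) * (s * y n)"
        using e_le_suminf[of m] e_nonneg[of m] ym y_pos[of m] by (intro mult_mono) auto
      finally show "x m + y m \<le> (2 + suminf e) * (s * y n)" .
      show "0 \<le> (2 + suminf e) * (s * y n)"
        using e_le_suminf[of m] e_nonneg[of m] s y_pos[of n] by auto
    qed
    also have "\<dots> = (2 + suminf e) / (1 - r) * s"
      using y_pos[of n] by simp
    finally show ?thesis by (simp add: s_def)
  qed
  have "summable (\<lambda>m. (2 + suminf e) / (1 - r) * offdiag_weight r n m)"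
    by (intro summable_mult summable_offdiag_weight r)
  then have "summable (\<lambda>m. norm (t m - 1))"
    by (rule summable_comparison_test'[OF _ le])
  then have "convergent_prod t"
    by (intro abs_convergent_prod_imp_convergent_prod summable_imp_abs_convergent_prod)
  then have "convergent (\<lambda>N. \<Prod>m\<le>N. t m)"
    by (rule convergent_prod_imp_convergent)
  then obtain c where "(\<lambda>N. \<Prod>m\<le>N. t m) \<longlonglongrightarrow> c"
    by (auto simp: convergent_def)
  then have "(\<lambda>N. \<Prod>m<Suc N. t m) \<longlonglongrightarrow> c"
    by (simp add: lessThan_Suc_atMost)
  then have lim: "(\<lambda>N. \<Prod>m<N. t m) \<longlonglongrightarrow> c"
    by (rule LIMSEQ_imp_Suc)
  have eq: "(\<Prod>m<N. t m) = partial_pi (\<lambda>m. - of_real (x m)) (\<lambda>m. of_real (y m)) N n" for N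
  proof -
    have "(\<Prod>m<N. t m) = (\<Prod>m\<in>{..<N} - {n}. t m)"
      by (rule prod.mono_neutral_right) (auto simp: t_def)
    then show ?thesis
      by (simp add: partial_pi_def t_def)
  qed
  show ?thesis
    using lim limI[OF lim] unfolding eq pi_seq_def partial_pi_def by simp
qed

end

section \<open>The discrete spectrum of an operator similar to a diagonal one\<close>

lemma bounded_op_zero:
  assumes R: "bounded_op X R" and x: "x \<in> seqs X"
  shows "R (\<lambda>_. 0) = (\<lambda>_. 0)"
proof -
  have "R (\<lambda>n. 0 * x n) = (\<lambda>n. 0 * R x n)"
    using R x unfolding bounded_op_def by blast
  then show ?thesis by simp
qed

text \<open>The resolvent of \<open>P (diag_op \<mu>) Q\<close> off the closure of \<open>range \<mu>\<close> is
  \<open>P (diag_op (1 / (\<mu> - z))) Q\<close>. Separation of the \<open>\<mu> n\<close> makes each of them an isolated point of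
  the spectrum and its generalized eigenspace the line spanned by \<open>P (unit_seq n)\<close>.\<close>

lemma diagonalizable_of_similar:
  assumes X: "X \<in> {ell p |p. 1 \<le> p} \<union> {c0_space}"
    and P: "bounded_op X P" and Q: "bounded_op X Q"
    and PQ: "\<And>x. x \<in> seqs X \<Longrightarrow> P (Q x) = x" and QP: "\<And>x. x \<in> seqs X \<Longrightarrow> Q (P x) = x"
    and T: "\<And>x. x \<in> seqs X \<Longrightarrow> T x = P (diag_op \<mu> (Q x))"
    and bdd: "\<And>n. norm (\<mu> n) \<le> B"
    and sep: "\<And>n. \<exists>\<delta>>0. \<forall>m. m \<noteq> n \<longrightarrow> \<delta> \<le> norm (\<mu> m - \<mu> n)"
  shows "diagonalizable X T"
proof -
  have D: "bounded_op X (diag_op \<mu>)"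
    using X bdd by (rule bounded_op_diag_op)
  have Pin: "P x \<in> seqs X" and Qin: "Q x \<in> seqs X" and Din: "diag_op \<mu> x \<in> seqs X"
    if "x \<in> seqs X" for x
    using P Q D that by (auto simp: bounded_op_def)
  have Tin: "T x \<in> seqs X" if "x \<in> seqs X" for x
    using that by (simp add: T Pin Qin Din)
  have scale: "(\<lambda>n. z * x n) \<in> seqs X" if "x \<in> seqs X" for x z
    using bounded_op_diag_op[OF X, of "\<lambda>_. z" "norm z"] that
    by (simp add: bounded_op_def diag_op_def)
  have zero: "(\<lambda>_. 0) \<in> seqs X"
    using scale[OF unit_seq_in_space[OF X, of 0], of 0] by simp
  have add: "(\<lambda>n. x n + y n) \<in> seqs X" if "x \<in> seqs X" "y \<in> seqs X" for x y
    using X that by (rule add_in_space)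
  have P0: "P (\<lambda>_. 0) = (\<lambda>_. 0)" and Q0: "Q (\<lambda>_. 0) = (\<lambda>_. 0)"
    using P Q zero by (auto intro: bounded_op_zero)
  have Qlin: "Q (\<lambda>n. x n - z * y n) = (\<lambda>n. Q x n - z * Q y n)"
    if "x \<in> seqs X" "y \<in> seqs X" for x y z
  proof -
    have "Q (\<lambda>n. x n + (- z) * y n) = (\<lambda>n. Q x n + Q (\<lambda>n. (- z) * y n) n)"
      using Q that scale by (simp only: bounded_op_def)
    also have "Q (\<lambda>n. (- z) * y n) = (\<lambda>n. (- z) * Q y n)"
      using Q that by (simp only: bounded_op_def)
    finally show ?thesis by simp
  qed
  have shift_in: "shift_op T z x \<in> seqs X" if "x \<in> seqs X" for x z
    using add[OF Tin[OF that] scale[OF that, of "- z"]] by (simp add: shift_op_def)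
  have Qshift: "Q (shift_op T z x) = (\<lambda>m. (\<mu> m - z) * Q x m)" if "x \<in> seqs X" for x z
  proof -
    have "Q (shift_op T z x) = (\<lambda>n. Q (T x) n - z * Q x n)"
      unfolding shift_op_def using that by (intro Qlin Tin)
    moreover have "Q (T x) = diag_op \<mu> (Q x)"
      using that by (simp add: T QP Qin Din)
    ultimately show ?thesis
      by (simp add: diag_op_def algebra_simps)
  qed
  have eigen: "T (P (unit_seq n)) = (\<lambda>m. \<mu> n * P (unit_seq n) m)" for n
  proof -
    have "diag_op \<mu> (unit_seq n) = (\<lambda>m. \<mu> n * unit_seq n m)"
      by (auto simp: diag_op_def unit_seq_def)
    moreover have "P (\<lambda>m. \<mu> n * unit_seq n m) = (\<lambda>m. \<mu> n * P (unit_seq n) m)"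
      using P unit_seq_in_space[OF X] by (auto simp: bounded_op_def)
    ultimately show ?thesis
      using unit_seq_in_space[OF X] by (simp add: T QP Pin)
  qed
  have nz: "P (unit_seq n) \<noteq> (\<lambda>_. 0)" for n
  proof
    assume "P (unit_seq n) = (\<lambda>_. 0)"
    then have "unit_seq n = Q (\<lambda>_. 0)"
      using QP[OF unit_seq_in_space[OF X]] by metis
    then have "unit_seq n n = 0" by (simp add: Q0)
    then show False by (simp add: unit_seq_def)
  qed
  have eigenvalue: "is_eigenvalue X T z \<longleftrightarrow> z \<in> range \<mu>" for z
  proof
    assume "is_eigenvalue X T z"
    then obtain x where x: "x \<in> seqs X" "x \<noteq> (\<lambda>_. 0)" "T x = (\<lambda>n. z * x n)"
      by (auto simp: is_eigenvalue_def)
    then have "shift_op T z x = (\<lambda>_. 0)" by (simp add: shift_op_def)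
    then have *: "(\<mu> m - z) * Q x m = 0" for m
      using Qshift[OF x(1), of z] Q0 by (metis (full_types))
    have "Q x \<noteq> (\<lambda>_. 0)"
      using x PQ P0 by metis
    then obtain m where "Q x m \<noteq> 0" by auto
    then show "z \<in> range \<mu>" using *[of m] by auto
  next
    assume "z \<in> range \<mu>"
    then obtain n where "z = \<mu> n" by auto
    then show "is_eigenvalue X T z"
      using nz[of n] eigen[of n] Pin[OF unit_seq_in_space[OF X, of n]]
      unfolding is_eigenvalue_def by blast
  qed
  have resolvent: "z \<notin> op_spectrum X T" if "0 < \<delta>" and \<delta>: "\<And>m. \<delta> \<le> norm (\<mu> m - z)" for z \<delta>
  proof -
    define \<rho> where "\<rho> m = 1 / (\<mu> m - z)" for m
    have \<mu>z: "\<mu> m - z \<noteq> 0" for m using \<open>0 < \<delta>\<close> \<delta>[of m] by auto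
    have "norm (\<rho> m) \<le> 1 / \<delta>" for m
      using \<open>0 < \<delta>\<close> \<delta>[of m] by (auto simp: \<rho>_def norm_divide intro!: divide_left_mono mult_pos_pos)
    then have R: "bounded_op X (diag_op \<rho>)" by (rule bounded_op_diag_op[OF X])
    define S where "S x = P (diag_op \<rho> (Q x))" for x
    have S: "bounded_op X S"
      using bounded_op_comp[OF X P bounded_op_comp[OF X R Q]] by (simp add: S_def[abs_def])
    have \<rho>1: "diag_op \<rho> (\<lambda>m. (\<mu> m - z) * u m) = u" for u
      using \<mu>z by (auto simp: diag_op_def \<rho>_def)
    have \<rho>2: "(\<lambda>m. (\<mu> m - z) * diag_op \<rho> u m) = u" for u
      using \<mu>z by (auto simp: diag_op_def \<rho>_def)
    have "S (shift_op T z x) = x" if "x \<in> seqs X" for x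
      unfolding S_def Qshift[OF that] \<rho>1 by (rule PQ[OF that])
    moreover have "shift_op T z (S x) = x" if x: "x \<in> seqs X" for x
    proof -
      have Sx: "S x \<in> seqs X" using S x by (simp add: bounded_op_def)
      have "diag_op \<rho> (Q x) \<in> seqs X" using R Qin[OF x] by (simp add: bounded_op_def)
      then have "Q (S x) = diag_op \<rho> (Q x)"
        unfolding S_def by (rule QP)
      then have "Q (shift_op T z (S x)) = Q x"
        unfolding Qshift[OF Sx] by (simp only: \<rho>2)
      then show ?thesis
        using PQ[OF shift_in[OF Sx]] PQ[OF x] by metis
    qed
    ultimately show ?thesis
      using S by (auto simp: op_spectrum_def)
  qed
  have spectrum: "\<mu> n \<in> op_spectrum X T" for n
  proof -
    have False if R: "bounded_op X R" and *: "\<And>x. x \<in> seqs X \<Longrightarrow> R (shift_op T (\<mu> n) x) = x" for R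
    proof -
      have "shift_op T (\<mu> n) (P (unit_seq n)) = (\<lambda>_. 0)"
        using eigen[of n] by (simp add: shift_op_def)
      then have "P (unit_seq n) = R (\<lambda>_. 0)"
        using *[OF Pin[OF unit_seq_in_space[OF X, of n]]] by simp
      moreover have "R (\<lambda>_. 0) = (\<lambda>_. 0)"
        using R zero by (rule bounded_op_zero)
      ultimately show False using nz[of n] by simp
    qed
    then show ?thesis by (auto simp: op_spectrum_def)
  qed
  have isolated: "\<mu> n isolated_in op_spectrum X T" for n
  proof -
    obtain \<delta> where \<delta>: "0 < \<delta>" "\<And>m. m \<noteq> n \<Longrightarrow> \<delta> \<le> norm (\<mu> m - \<mu> n)"
      using sep[of n] by auto
    have "z \<notin> op_spectrum X T" if "z \<in> ball (\<mu> n) (\<delta> / 2)" "z \<noteq> \<mu> n" for z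
    proof (rule resolvent)
      show "0 < min (\<delta> / 2) (norm (\<mu> n - z))" using \<delta> that by auto
      show "min (\<delta> / 2) (norm (\<mu> n - z)) \<le> norm (\<mu> m - z)" for m
      proof (cases "m = n")
        case False
        have "norm (\<mu> m - \<mu> n) \<le> norm (\<mu> m - z) + norm (\<mu> n - z)"
          using norm_triangle_ineq4[of "\<mu> m - z" "\<mu> n - z"] by simp
        moreover have "norm (\<mu> n - z) < \<delta> / 2" using that by (simp add: dist_norm)
        ultimately show ?thesis using \<delta>(2)[OF False] by linarith
      qed auto
    qed
    moreover have "\<mu> n \<in> ball (\<mu> n) (\<delta> / 2)"
      using \<delta>(1) by simp
    ultimately have "ball (\<mu> n) (\<delta> / 2) \<inter> op_spectrum X T = {\<mu> n}"
      using spectrum[of n] by blast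
    then show ?thesis
      using spectrum[of n] by (auto simp: isolated_in_def intro!: exI[of _ "ball (\<mu> n) (\<delta> / 2)"])
  qed
  have fin_dim: "finite_dim (gen_eigenspace X T (\<mu> n))" for n
  proof -
    have "x = (\<lambda>i. \<Sum>v\<in>{P (unit_seq n)}. Q x n * v i)"
      if x: "x \<in> gen_eigenspace X T (\<mu> n)" for x
    proof -
      obtain j where xX: "x \<in> seqs X" and j: "(shift_op T (\<mu> n) ^^ j) x = (\<lambda>_. 0)"
        using x by (auto simp: gen_eigenspace_def)
      have iter: "(shift_op T z ^^ i) x \<in> seqs X
          \<and> Q ((shift_op T z ^^ i) x) = (\<lambda>m. (\<mu> m - z) ^ i * Q x m)" for i z
        by (induction i) (auto simp: xX shift_in Qshift)
      have "(\<mu> m - \<mu> n) ^ j * Q x m = 0" for m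
        using iter[of j "\<mu> n"] j Q0 by (metis (full_types))
      moreover have "\<mu> m \<noteq> \<mu> n" if "m \<noteq> n" for m
        using sep[of n] that by force
      ultimately have "Q x m = Q x n * unit_seq n m" for m
        by (cases "m = n") (auto simp: unit_seq_def)
      then have "Q x = (\<lambda>m. Q x n * unit_seq n m)"
        by (rule ext)
      then have "P (Q x) = (\<lambda>m. Q x n * P (unit_seq n) m)"
        using P unit_seq_in_space[OF X, of n] unfolding bounded_op_def by metis
      then show ?thesis using PQ[OF xX] by simp
    qed
    then show ?thesis
      unfolding finite_dim_def
      by (intro exI[of _ "{P (unit_seq n)}"] conjI ballI) (simp, rule exI)
  qed
  have "range \<mu> = disc_spectrum X T"
    using isolated fin_dim by (auto simp: disc_spectrum_def eigenvalue)
  then show ?thesis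
    unfolding diagonalizable_def using P Q D PQ QP T by blast
qed

section \<open>Passing from truncations to the infinite system\<close>

text \<open>Tannery's theorem in the form needed below: the summands depend on the truncation
  parameter \<open>N\<close>, and so does the range of summation.\<close>

lemma truncated_sum_tendsto:
  fixes f z :: "nat \<Rightarrow> nat \<Rightarrow> complex"
  assumes f: "\<And>j. (\<lambda>N. f N j) \<longlonglongrightarrow> g j" "\<And>N j. norm (f N j) \<le> w j" and w: "summable w"
    and z: "\<And>j. (\<lambda>N. z N j) \<longlonglongrightarrow> y j" "\<And>N j. norm (z N j) \<le> B"
  shows "(\<lambda>N. \<Sum>j<N. f N j * z N j) \<longlonglongrightarrow> (\<Sum>j. g j * y j)"
proof -
  define h where "h j N = (if j < N then f N j * z N j else 0)" for j N
  have "(\<lambda>N. \<Sum>j. h j N) \<longlonglongrightarrow> (\<Sum>j. g j * y j)"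
  proof (rule tannerys_theorem[THEN conjunct2, THEN conjunct2])
    fix j
    have "(\<lambda>N. f N j * z N j) \<longlonglongrightarrow> g j * y j"
      by (intro tendsto_mult f z)
    then show "h j \<longlonglongrightarrow> g j * y j"
      by (rule Lim_transform_eventually)
         (auto simp: h_def intro!: eventually_sequentiallyI[of "Suc j"])
  next
    have "norm (h j N) \<le> w j * B" for j N
    proof -
      have w0: "0 \<le> w j" and B0: "0 \<le> B"
        using order_trans[OF norm_ge_zero f(2)] order_trans[OF norm_ge_zero z(2)] by auto
      then show ?thesis
        using mult_mono[OF f(2)[of N j] z(2)[of N j]] by (auto simp: h_def norm_mult)
    qed
    then show "\<forall>\<^sub>F (j, N) in sequentially \<times>\<^sub>F sequentially. norm (h j N) \<le> w j * B"
      by (intro always_eventually) auto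
    show "summable (\<lambda>j. w j * B)"
      using w by (rule summable_mult2)
  qed auto
  moreover have "(\<Sum>j. h j N) = (\<Sum>j<N. f N j * z N j)" for N
    by (subst suminf_finite[of "{..<N}"]) (auto simp: h_def)
  ultimately show ?thesis by simp
qed

lemma mat_op_truncation_tendsto:
  assumes M: "\<And>N. localized C r (M N)" "\<And>j. (\<lambda>N. M N i j) \<longlonglongrightarrow> L i j"
    and z: "\<And>j. (\<lambda>N. z N j) \<longlonglongrightarrow> y j" "\<And>N j. norm (z N j) \<le> B"
  shows "(\<lambda>N. \<Sum>j<N. M N i j * z N j) \<longlonglongrightarrow> mat_op L y i"
  unfolding mat_op_def
proof (rule truncated_sum_tendsto[OF M(2) _ _ z])
  show "norm (M N i j) \<le> C * offdiag_weight r i j" for N j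
    using M(1) by (simp add: localized_def)
  show "summable (\<lambda>j. C * offdiag_weight r i j)"
    using M(1)[of 0] by (intro summable_mult summable_offdiag_weight) (auto simp: localized_def)
qed

lemma norm_truncated_row_le:
  assumes M: "localized C r M" and x: "\<And>j. norm (x j) \<le> B"
  shows "norm (\<Sum>j<N. M i j * x j) \<le> C * (2 / (1 - r)) * B"
proof -
  have "norm (mat_op M (\<lambda>j. if j < N then x j else 0) i) \<le> C * (2 / (1 - r)) * B"
    using order_trans[OF norm_ge_zero x] by (intro mat_op_bound[OF M]) (simp add: x)
  moreover have "mat_op M (\<lambda>j. if j < N then x j else 0) i = (\<Sum>j<N. M i j * x j)"
    unfolding mat_op_def by (subst suminf_finite[of "{..<N}"]) auto
  ultimately show ?thesis by simp
qed

text \<open>The finite identity holds for the sections of \<open>F N\<close> and \<open>G N\<close>, whose entries may themselves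
  change with \<open>N\<close>. Dominated convergence is applied first to the inner sum and then, with the
  uniform bound for its values, to the outer one.\<close>

lemma mat_op_inverse_of_truncations:
  assumes F: "\<And>N. localized C r (F N)" "\<And>i j. (\<lambda>N. F N i j) \<longlonglongrightarrow> F' i j"
    and G: "\<And>N. localized D s (G N)" "\<And>i j. (\<lambda>N. G N i j) \<longlonglongrightarrow> G' i j"
    and inv: "\<And>N i j. i < N \<Longrightarrow> j < N \<Longrightarrow> (\<Sum>m<N. F N i m * G N m j) = of_bool (i = j)"
    and x: "\<And>j. norm (x j) \<le> B"
  shows "mat_op F' (mat_op G' x) = x"
proof
  fix i
  have "(\<lambda>N. \<Sum>m<N. F N i m * (\<Sum>j<N. G N m j * x j)) \<longlonglongrightarrow> mat_op F' (mat_op G' x) i"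
    by (rule mat_op_truncation_tendsto[OF F mat_op_truncation_tendsto[OF G tendsto_const x]
          norm_truncated_row_le[OF G(1) x]])
  moreover have "\<forall>\<^sub>F N in sequentially. (\<Sum>m<N. F N i m * (\<Sum>j<N. G N m j * x j)) = x i"
  proof (rule eventually_sequentiallyI[of "Suc i"])
    fix N assume N: "Suc i \<le> N"
    have "(\<Sum>m<N. F N i m * (\<Sum>j<N. G N m j * x j)) = (\<Sum>m<N. \<Sum>j<N. F N i m * G N m j * x j)"
      by (simp add: sum_distrib_left mult.assoc)
    also have "\<dots> = (\<Sum>j<N. (\<Sum>m<N. F N i m * G N m j) * x j)"
      by (subst sum.swap) (simp add: sum_distrib_right)
    also have "\<dots> = (\<Sum>j<N. of_bool (i = j) * x j)"
      using N by (intro sum.cong) (auto simp: inv)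
    also have "\<dots> = (\<Sum>j<N. if j = i then x j else 0)"
      by (intro sum.cong) auto
    also have "\<dots> = x i"
      using N by simp
    finally show "(\<Sum>m<N. F N i m * (\<Sum>j<N. G N m j * x j)) = x i" .
  qed
  then have "(\<lambda>N. \<Sum>m<N. F N i m * (\<Sum>j<N. G N m j * x j)) \<longlonglongrightarrow> x i"
    by (rule tendsto_eventually)
  ultimately show "mat_op F' (mat_op G' x) i = x i"
    by (rule LIMSEQ_unique)
qed

section \<open>Eigenvectors of the closed loop and their inverse\<close>

text \<open>The eigenvalues to be placed are \<open>- c n\<close>. With this sign the Cauchy kernel
  \<open>1 / (a m + c n)\<close> turns into its transpose when \<open>a\<close> and \<open>c\<close> are exchanged, while the
  assumptions are invariant. Every fact thus has a mirror image, which turns the left inverse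
  of the Cauchy matrix into a right inverse and one family of products into the other.\<close>

locale placement =
  fixes a c :: "nat \<Rightarrow> real" and b :: cseq and e :: "nat \<Rightarrow> real" and r K :: real
  assumes r: "0 < r" "r < 1" and a_pos: "\<And>n. 0 < a n" and c_pos: "\<And>n. 0 < c n"
    and b_nz: "\<And>n. b n \<noteq> 0"
    and a_decay: "\<And>n m. n \<le> m \<Longrightarrow> a m \<le> r ^ (m - n) * a n"
    and c_decay: "\<And>n m. n \<le> m \<Longrightarrow> c m \<le> r ^ (m - n) * c n"
    and b_decay: "\<And>n m. n \<le> m \<Longrightarrow> norm (b m) \<le> K * r ^ (m - n) * norm (b n)"
    and g_decay: "\<And>n m. n \<le> m \<Longrightarrow>
      (a m + c m) / norm (b m) \<le> K * r ^ (m - n) * ((a n + c n) / norm (b n))"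
    and e_nonneg: "\<And>n. 0 \<le> e n" and e_summable: "summable e"
    and c_le: "\<And>n. c n \<le> (1 + e n) * a n" and a_le: "\<And>n. a n \<le> (1 + e n) * c n"
begin

lemma swap: "placement c a b e r K"
  using r a_pos c_pos b_nz a_decay c_decay b_decay g_decay e_nonneg e_summable c_le a_le
  by unfold_locales (simp_all add: add.commute)

sublocale ca: comparable_decay c a e r
  using r a_pos c_pos a_decay e_nonneg e_summable c_le
  by unfold_locales (auto simp: less_imp_le)

abbreviation A :: cseq where "A \<equiv> \<lambda>n. complex_of_real (a n)"
abbreviation C :: cseq where "C \<equiv> \<lambda>n. complex_of_real (c n)"

definition eigvec_mat :: "nat \<Rightarrow> nat \<Rightarrow> complex" where
  "eigvec_mat m n = b m / b n * ((A n + C n) / (A m + C n))"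

lemma K_nonneg: "0 \<le> K"
  using b_decay[of 0 0] b_nz[of 0] order_trans[OF norm_ge_zero[of "b 0"] b_decay[of 0 0]]
  by (simp add: zero_le_mult_iff)

text \<open>Below the diagonal the decay of \<open>b\<close> gives the geometric factor and \<open>a n + c n\<close> is
  comparable with \<open>c n\<close>. Above the diagonal it comes from the decay of \<open>(a n + c n) / b n\<close>, and
  \<open>a m + c m\<close> is comparable with \<open>a m\<close>.\<close>

lemma eigvec_mat_localized: "localized (K * (2 + suminf e)) r eigvec_mat"
proof -
  have "norm (eigvec_mat m n) \<le> K * (2 + suminf e) * offdiag_weight r m n" for m n
  proof -
    have pos: "0 < a m" "0 < a n" "0 < c m" "0 < c n" "0 < norm (b m)" "0 < norm (b n)"
      using a_pos c_pos b_nz by auto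
    have norm_eq: "norm (eigvec_mat m n) = norm (b m) / norm (b n) * ((a n + c n) / (a m + c n))"
      using pos by (simp add: eigvec_mat_def norm_mult norm_divide flip: of_real_add)
    show ?thesis
    proof (cases "n \<le> m")
      case True
      have "norm (b m) / norm (b n) \<le> K * r ^ (m - n)"
        using b_decay[OF True] pos by (simp add: divide_le_eq)
      moreover have "(a n + c n) / (a m + c n) \<le> 2 + suminf e"
      proof -
        have "a n + c n \<le> (2 + e n) * c n"
          using a_le[of n] by (simp add: algebra_simps)
        also have "\<dots> \<le> (2 + suminf e) * (a m + c n)"
          using ca.e_le_suminf[of n] e_nonneg[of n] pos by (intro mult_mono) auto
        finally show ?thesis using pos by (simp add: divide_le_eq)
      qed
      ultimately have "norm (eigvec_mat m n) \<le> K * r ^ (m - n) * (2 + suminf e)"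
        unfolding norm_eq using pos K_nonneg r by (intro mult_mono) auto
      then show ?thesis using True by (simp add: offdiag_weight_def mult_ac)
    next
      case False
      have "(a n + c n) / norm (b n) \<le> K * r ^ (n - m) * ((a m + c m) / norm (b m))"
        using False by (intro g_decay) auto
      then have "(a n + c n) / norm (b n) * (norm (b m) / (a m + c n))
          \<le> K * r ^ (n - m) * ((a m + c m) / norm (b m)) * (norm (b m) / (a m + c n))"
        using pos by (intro mult_right_mono) auto
      also have "\<dots> = K * r ^ (n - m) * ((a m + c m) / (a m + c n))"
        using pos by simp
      also have "\<dots> \<le> K * r ^ (n - m) * (2 + suminf e)"
      proof (rule mult_left_mono)
        have "a m + c m \<le> (2 + e m) * a m"
          using c_le[of m] by (simp add: algebra_simps)
        also have "\<dots> \<le> (2 + suminf e) * (a m + c n)"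
          using ca.e_le_suminf[of m] e_nonneg[of m] pos by (intro mult_mono) auto
        finally show "(a m + c m) / (a m + c n) \<le> 2 + suminf e"
          using pos by (simp add: divide_le_eq)
      qed (use K_nonneg r in auto)
      finally show ?thesis
        using False by (simp add: norm_eq offdiag_weight_def mult_ac)
    qed
  qed
  then show ?thesis using r by (simp add: localized_def)
qed

definition partial_pi_ca :: "nat \<Rightarrow> cseq" where
  "partial_pi_ca = partial_pi (\<lambda>k. - C k) A"

definition partial_pi_ac :: "nat \<Rightarrow> cseq" where
  "partial_pi_ac = partial_pi (\<lambda>k. - A k) C"

text \<open>Up to the two products, entry \<open>(n, m)\<close> of the inverse is the same entry of \<open>eigvec_mat\<close> with
  \<open>a\<close> and \<open>c\<close> exchanged.\<close>

definition coeff_mat :: "nat \<Rightarrow> nat \<Rightarrow> nat \<Rightarrow> complex" where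
  "coeff_mat N n m = b n / b m * ((A m + C m) / (A m + C n)) * partial_pi_ca N m * partial_pi_ac N n"

definition coeff_mat_lim :: "nat \<Rightarrow> nat \<Rightarrow> complex" where
  "coeff_mat_lim n m = b n / b m * ((A m + C m) / (A m + C n))
    * pi_seq (\<lambda>k. - C k) A m * pi_seq (\<lambda>k. - A k) C n"

lemma partial_pi_ca_tendsto: "(\<lambda>N. partial_pi_ca N n) \<longlonglongrightarrow> pi_seq (\<lambda>k. - C k) A n"
  unfolding partial_pi_ca_def by (rule ca.partial_pi_tendsto)

lemma norm_partial_pi_ca: "norm (partial_pi_ca N n) \<le> ca.pi_bound"
  unfolding partial_pi_ca_def by (rule ca.norm_partial_pi_le)

lemma comparable_ac: "comparable_decay a c e r"
  using placement.swap[OF swap] placement.c_decay r a_pos c_pos c_decay e_nonneg e_summable a_le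
  by unfold_locales (auto simp: less_imp_le)

lemma partial_pi_ac_tendsto: "(\<lambda>N. partial_pi_ac N n) \<longlonglongrightarrow> pi_seq (\<lambda>k. - A k) C n"
  unfolding partial_pi_ac_def by (rule comparable_decay.partial_pi_tendsto[OF comparable_ac])

lemma norm_partial_pi_ac: "norm (partial_pi_ac N n) \<le> ca.pi_bound"
  unfolding partial_pi_ac_def
  using comparable_decay.norm_partial_pi_le[OF comparable_ac]
  by (simp add: comparable_decay.pi_bound_def[OF comparable_ac] ca.pi_bound_def)

lemma coeff_mat_tendsto: "(\<lambda>N. coeff_mat N n m) \<longlonglongrightarrow> coeff_mat_lim n m"
  unfolding coeff_mat_def coeff_mat_lim_def
  by (intro tendsto_intros partial_pi_ca_tendsto partial_pi_ac_tendsto)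

lemma coeff_mat_localized:
  "localized (K * (2 + suminf e) * ca.pi_bound * ca.pi_bound) r (coeff_mat N)"
proof -
  interpret sw: placement c a b e r K by (rule swap)
  have "norm (coeff_mat N n m)
      \<le> K * (2 + suminf e) * ca.pi_bound * ca.pi_bound * offdiag_weight r n m" for n m
  proof -
    have "coeff_mat N n m = sw.eigvec_mat n m * partial_pi_ca N m * partial_pi_ac N n"
      by (simp add: coeff_mat_def sw.eigvec_mat_def add.commute)
    also have "norm \<dots> \<le> K * (2 + suminf e) * offdiag_weight r n m * ca.pi_bound * ca.pi_bound"
      unfolding norm_mult
    proof (intro mult_mono norm_partial_pi_ca norm_partial_pi_ac)
      show "norm (sw.eigvec_mat n m) \<le> K * (2 + suminf e) * offdiag_weight r n m"
        using sw.eigvec_mat_localized by (simp add: localized_def)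
      then show "0 \<le> K * (2 + suminf e) * offdiag_weight r n m"
        by (rule order_trans[OF norm_ge_zero])
      then show "0 \<le> K * (2 + suminf e) * offdiag_weight r n m * ca.pi_bound"
        using ca.pi_bound_pos by simp
    qed auto
    finally show ?thesis by (simp add: mult_ac)
  qed
  then show ?thesis using r by (simp add: localized_def)
qed

lemma coeff_mat_lim_localized:
  "localized (K * (2 + suminf e) * ca.pi_bound * ca.pi_bound) r coeff_mat_lim"
proof -
  have "norm (coeff_mat_lim n m)
      \<le> K * (2 + suminf e) * ca.pi_bound * ca.pi_bound * offdiag_weight r n m" for n m
    using coeff_mat_localized
    by (intro LIMSEQ_le_const2[OF tendsto_norm[OF coeff_mat_tendsto]]) (auto simp: localized_def)
  then show ?thesis using r by (simp add: localized_def)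
qed

lemma a_inj: "inj_on A {..<N}"
proof -
  have "a m \<noteq> a n" if "m \<noteq> n" for m n
    using ca.y_dist(1)[OF that] ca.weight_le_r[OF that] r a_pos[of m]
    by (auto simp: mult_le_0_iff)
  then show ?thesis by (auto simp: inj_on_def)
qed

lemma sum_nz: "A m + C n \<noteq> 0"
proof -
  have "a m + c n \<noteq> 0" using a_pos[of m] c_pos[of n] by simp
  then show ?thesis by (simp flip: of_real_add)
qed

lemma cauchy_inverse_ac:
  assumes "n < N" "j < N"
  shows "(\<Sum>m<N. (A n + C n) * (A m + C m) * partial_pi_ca N m * partial_pi_ac N n
    / ((A m + C n) * (A m + C j))) = of_bool (n = j)"
proof -
  interpret sw: placement c a b e r K by (rule swap)
  have "partial_pi A (\<lambda>k. - C k) N n = partial_pi_ac N n"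
    using partial_pi_minus[of A "\<lambda>k. - C k"] by (simp add: partial_pi_ac_def)
  moreover have "inj_on (\<lambda>k. - C k) {..<N}"
    using sw.a_inj[of N] by (auto simp: inj_on_def)
  ultimately show ?thesis
    using cauchy_inverse[of A "\<lambda>k. - C k" N n j] assms a_inj a_pos c_pos sum_nz
    by (simp add: partial_pi_ca_def less_imp_neq[symmetric] eq_neg_iff_add_eq_0)
qed

lemma coeff_mat_eigvec_mat:
  assumes "n < N" "j < N"
  shows "(\<Sum>m<N. coeff_mat N n m * eigvec_mat m j) = of_bool (n = j)"
proof -
  have "(\<Sum>m<N. coeff_mat N n m * eigvec_mat m j)
    = b n / b j * ((A j + C j) / (A n + C n))
      * (\<Sum>m<N. (A n + C n) * (A m + C m) * partial_pi_ca N m * partial_pi_ac N n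
          / ((A m + C n) * (A m + C j)))"
    unfolding sum_distrib_left
    by (intro sum.cong) (simp_all add: coeff_mat_def eigvec_mat_def b_nz sum_nz mult_ac)
  also have "\<dots> = of_bool (n = j)"
    unfolding cauchy_inverse_ac[OF assms] using b_nz sum_nz by simp
  finally show ?thesis .
qed

lemma eigvec_mat_coeff_mat:
  assumes "m < N" "j < N"
  shows "(\<Sum>n<N. eigvec_mat m n * coeff_mat N n j) = of_bool (m = j)"
proof -
  interpret sw: placement c a b e r K by (rule swap)
  have sw_pi: "sw.partial_pi_ca = partial_pi_ac" "sw.partial_pi_ac = partial_pi_ca"
    by (simp_all add: sw.partial_pi_ca_def sw.partial_pi_ac_def partial_pi_ca_def partial_pi_ac_def)
  have "(\<Sum>n<N. eigvec_mat m n * coeff_mat N n j)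
    = b m / b j
      * (\<Sum>n<N. (C j + A j) * (C n + A n) * sw.partial_pi_ca N n * sw.partial_pi_ac N j
          / ((C n + A j) * (C n + A m)))"
    unfolding sum_distrib_left sw_pi
    by (intro sum.cong) (simp_all add: coeff_mat_def eigvec_mat_def b_nz sum_nz add.commute mult_ac)
  also have "\<dots> = of_bool (m = j)"
    unfolding sw.cauchy_inverse_ac[OF assms(2,1)] using b_nz by auto
  finally show ?thesis .
qed

lemma eigvec_mat_inverse:
  assumes "\<And>j. norm (x j) \<le> B"
  shows "mat_op eigvec_mat (mat_op coeff_mat_lim x) = x"
    and "mat_op coeff_mat_lim (mat_op eigvec_mat x) = x"
proof -
  show "mat_op eigvec_mat (mat_op coeff_mat_lim x) = x"
    by (rule mat_op_inverse_of_truncations[where F = "\<lambda>_. eigvec_mat" and G = coeff_mat,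
          OF eigvec_mat_localized tendsto_const coeff_mat_localized coeff_mat_tendsto _ assms])
       (rule eigvec_mat_coeff_mat)
  show "mat_op coeff_mat_lim (mat_op eigvec_mat x) = x"
    by (rule mat_op_inverse_of_truncations[where F = coeff_mat and G = "\<lambda>_. eigvec_mat",
          OF coeff_mat_localized coeff_mat_tendsto eigvec_mat_localized tendsto_const _ assms])
       (rule coeff_mat_eigvec_mat)
qed

definition partial_gain :: "nat \<Rightarrow> cseq" where
  "partial_gain N m = - ((A m + C m) / b m) * partial_pi_ca N m"

abbreviation gains :: cseq where "gains \<equiv> gain A b (\<lambda>n. - C n)"

lemma partial_gain_tendsto: "(\<lambda>N. partial_gain N m) \<longlonglongrightarrow> gains m"
proof -
  have "(\<lambda>N. - ((A m + C m) / b m) * partial_pi_ca N m)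
      \<longlonglongrightarrow> - ((A m + C m) / b m) * pi_seq (\<lambda>k. - C k) A m"
    by (intro tendsto_mult tendsto_const partial_pi_ca_tendsto)
  then show ?thesis
    by (simp only: partial_gain_def gain_def diff_minus_eq_add)
qed

text \<open>The scale \<open>(a m + c m) / \<bar>b m\<bar>\<close> decays geometrically from its value at \<open>0\<close>.\<close>

definition gain_majorant :: "nat \<Rightarrow> real" where
  "gain_majorant m = K * ((a 0 + c 0) / norm (b 0)) * ca.pi_bound * r ^ m"

lemma summable_gain_majorant: "summable gain_majorant"
  unfolding gain_majorant_def[abs_def] using r by (intro summable_mult summable_geometric) auto

lemma norm_scale_le: "norm ((A m + C m) / b m) \<le> K * r ^ m * ((a 0 + c 0) / norm (b 0))"
proof -
  have "norm ((A m + C m) / b m) = (a m + c m) / norm (b m)"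
    using a_pos[of m] c_pos[of m] by (simp add: norm_divide flip: of_real_add)
  then show ?thesis using g_decay[of 0 m] by simp
qed

lemma norm_partial_gain_le: "norm (partial_gain N m) \<le> gain_majorant m"
proof -
  have "norm (partial_gain N m) \<le> K * r ^ m * ((a 0 + c 0) / norm (b 0)) * ca.pi_bound"
    unfolding partial_gain_def norm_mult norm_minus_cancel
    using norm_scale_le[of m] norm_ge_zero order_trans
    by (intro mult_mono norm_partial_pi_ca) blast+
  then show ?thesis by (simp add: gain_majorant_def mult_ac)
qed

lemma summable_norm_gains: "summable (\<lambda>m. norm (gains m))"
proof (rule summable_comparison_test'[OF summable_gain_majorant])
  show "norm (norm (gains m)) \<le> gain_majorant m" for m
    using LIMSEQ_le_const2[OF tendsto_norm[OF partial_gain_tendsto]] norm_partial_gain_le by auto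
qed

text \<open>This identity is where the particular choice of gains enters: the residues sum to \<open>1\<close>.\<close>

lemma partial_gain_eigvec_mat:
  assumes "n < N"
  shows "(\<Sum>m<N. partial_gain N m * eigvec_mat m n) = - ((A n + C n) / b n)"
proof -
  have "(\<Sum>m<N. partial_gain N m * eigvec_mat m n)
    = - ((A n + C n) / b n) * (\<Sum>m<N. (A m + C m) * partial_pi_ca N m / (A m + C n))"
    unfolding sum_distrib_left
    by (intro sum.cong) (simp_all add: partial_gain_def eigvec_mat_def b_nz)
  also have "(\<Sum>m<N. (A m + C m) * partial_pi_ca N m / (A m + C n)) = 1"
    using sum_residues[of A "\<lambda>k. - C k" N n] assms a_inj a_pos sum_nz
    by (simp add: partial_pi_ca_def less_imp_neq[symmetric] eq_neg_iff_add_eq_0)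
  finally show ?thesis by simp
qed

lemma summable_scaled:
  assumes "\<And>j. norm (x j) \<le> B"
  shows "summable (\<lambda>n. (A n + C n) / b n * x n)"
proof (rule summable_comparison_test'[where N = 0])
  show "summable (\<lambda>n. K * r ^ n * ((a 0 + c 0) / norm (b 0)) * B)"
    using r by (intro summable_mult summable_mult2 summable_geometric) auto
  show "norm ((A n + C n) / b n * x n) \<le> K * r ^ n * ((a 0 + c 0) / norm (b 0)) * B" for n
    unfolding norm_mult using norm_scale_le[of n] assms[of n] norm_ge_zero order_trans
    by (intro mult_mono) blast+
qed

lemma gains_eigvec_mat:
  assumes x: "\<And>j. norm (x j) \<le> B"
  shows "seq_functional gains (mat_op eigvec_mat x) = - (\<Sum>n. (A n + C n) / b n * x n)"
proof -
  have "(\<lambda>N. \<Sum>m<N. partial_gain N m * (\<Sum>n<N. eigvec_mat m n * x n))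
      \<longlonglongrightarrow> seq_functional gains (mat_op eigvec_mat x)"
    unfolding seq_functional_def
    by (rule truncated_sum_tendsto[OF partial_gain_tendsto norm_partial_gain_le
          summable_gain_majorant
          mat_op_truncation_tendsto[OF eigvec_mat_localized tendsto_const tendsto_const x]
          norm_truncated_row_le[OF eigvec_mat_localized x]])
  moreover have "(\<Sum>m<N. partial_gain N m * (\<Sum>n<N. eigvec_mat m n * x n))
      = - (\<Sum>n<N. (A n + C n) / b n * x n)" for N
  proof -
    have "(\<Sum>m<N. partial_gain N m * (\<Sum>n<N. eigvec_mat m n * x n))
        = (\<Sum>m<N. \<Sum>n<N. partial_gain N m * eigvec_mat m n * x n)"
      by (simp add: sum_distrib_left mult.assoc)
    also have "\<dots> = (\<Sum>n<N. (\<Sum>m<N. partial_gain N m * eigvec_mat m n) * x n)"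
      by (subst sum.swap) (simp add: sum_distrib_right)
    also have "\<dots> = - (\<Sum>n<N. (A n + C n) / b n * x n)"
      by (simp add: partial_gain_eigvec_mat sum_negf)
    finally show ?thesis .
  qed
  moreover have "(\<lambda>N. - (\<Sum>n<N. (A n + C n) / b n * x n)) \<longlonglongrightarrow> - (\<Sum>n. (A n + C n) / b n * x n)"
    by (intro tendsto_minus summable_LIMSEQ summable_scaled[OF x])
  ultimately show ?thesis
    by (metis (no_types, lifting) LIMSEQ_unique ext)
qed

text \<open>Since the functional has the value \<open>- (a n + c n) / b n\<close> on column \<open>n\<close>, the eigenvector
  equation reduces to \<open>a m / (a m + c n) - 1 = - c n / (a m + c n)\<close> in row \<open>m\<close>.\<close>

lemma feedback_op_eigvec_mat:
  assumes x: "\<And>j. norm (x j) \<le> B"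
  shows "feedback_op A b gains (mat_op eigvec_mat x) = mat_op eigvec_mat (diag_op (\<lambda>n. - C n) x)"
proof
  fix m
  have s: "summable (\<lambda>n. eigvec_mat m n * x n)"
    by (rule mat_op_row(2)[OF eigvec_mat_localized x])
  have entry: "A m * (eigvec_mat m n * x n) - b m * ((A n + C n) / b n * x n)
      = eigvec_mat m n * (- C n * x n)" for n
    using b_nz[of n] sum_nz[of m n]
    by (simp add: eigvec_mat_def divide_simps) (simp add: algebra_simps)
  have "feedback_op A b gains (mat_op eigvec_mat x) m
      = A m * (\<Sum>n. eigvec_mat m n * x n) - b m * (\<Sum>n. (A n + C n) / b n * x n)"
    unfolding feedback_op_def gains_eigvec_mat[OF x] diag_op_def by (simp add: mat_op_def)
  also have "\<dots> = (\<Sum>n. A m * (eigvec_mat m n * x n)) - (\<Sum>n. b m * ((A n + C n) / b n * x n))"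
    by (simp only: suminf_mult[OF s] suminf_mult[OF summable_scaled[OF x]])
  also have "\<dots> = (\<Sum>n. A m * (eigvec_mat m n * x n) - b m * ((A n + C n) / b n * x n))"
    by (intro suminf_diff summable_mult s summable_scaled[OF x])
  also have "\<dots> = mat_op eigvec_mat (diag_op (\<lambda>n. - C n) x) m"
    by (simp only: entry mat_op_def diag_op_def)
  finally show "feedback_op A b gains (mat_op eigvec_mat x) m
      = mat_op eigvec_mat (diag_op (\<lambda>n. - C n) x) m" .
qed

lemma gains_in_dual:
  assumes "X \<in> {ell p |p. 1 \<le> p} \<union> {c_space, c0_space}"
  shows "gains \<in> seq_dual X"
  using assms summable_norm_gains by (rule summable_in_dual)

lemma feedback_diagonalizable:
  assumes X: "X \<in> {ell p |p. 1 \<le> p} \<union> {c0_space}"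
  shows "diagonalizable X (feedback_op A b gains)"
proof (rule diagonalizable_of_similar[OF X])
  interpret sw: placement c a b e r K by (rule swap)
  show P: "bounded_op X (mat_op eigvec_mat)" and Q: "bounded_op X (mat_op coeff_mat_lim)"
    using bounded_op_mat_op[OF X] eigvec_mat_localized coeff_mat_lim_localized by blast+
  have bdd: "norm (x j) \<le> seq_norm X x" if "x \<in> seqs X" for x j
    using X that by (intro norm_le_seq_norm) auto
  show PQ: "mat_op eigvec_mat (mat_op coeff_mat_lim x) = x"
    and "mat_op coeff_mat_lim (mat_op eigvec_mat x) = x" if "x \<in> seqs X" for x
    using eigvec_mat_inverse[OF bdd[OF that]] by auto
  show "feedback_op A b gains x
      = mat_op eigvec_mat (diag_op (\<lambda>n. - C n) (mat_op coeff_mat_lim x))" if x: "x \<in> seqs X" for x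
  proof -
    have "mat_op coeff_mat_lim x \<in> seqs X"
      using Q x by (simp add: bounded_op_def)
    from feedback_op_eigvec_mat[where x = "mat_op coeff_mat_lim x", OF bdd[OF this]] show ?thesis
      using PQ[OF x] by simp
  qed
  show "norm (- C n) \<le> c 0" for n
  proof -
    have "c n \<le> r ^ n * c 0" using c_decay[of 0 n] by simp
    also have "\<dots> \<le> 1 * c 0" using r c_pos[of 0] by (intro mult_right_mono power_le_one) auto
    finally show ?thesis using c_pos[of n] by simp
  qed
  show "\<exists>\<delta>>0. \<forall>m. m \<noteq> n \<longrightarrow> \<delta> \<le> norm (- C m - - C n)" for n
  proof (intro exI[of _ "(1 - r) * c n"] conjI allI impI)
    show "0 < (1 - r) * c n" using r c_pos by simp
    fix m :: nat assume "m \<noteq> n"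
    have "(1 - r) * c n \<le> (1 - offdiag_weight r n m) * max (c m) (c n)"
      using r sw.ca.weight_le_r[OF \<open>m \<noteq> n\<close>] c_pos[of n] by (intro mult_mono) auto
    also have "\<dots> \<le> \<bar>c n - c m\<bar>"
      by (rule sw.ca.y_dist(1)[OF \<open>m \<noteq> n\<close>])
    also have "\<dots> = norm (- C m - - C n)"
      by (simp add: norm_minus_commute flip: of_real_diff)
    finally show "(1 - r) * c n \<le> norm (- C m - - C n)" .
  qed
qed

end

section \<open>Uniformizing the decay rates\<close>

lemma unif_exp_decay_withE:
  assumes "unif_exp_decay_with \<alpha> x"
  obtains r where "0 < r" "r < 1" "\<And>n m. n \<le> m \<Longrightarrow> x m \<le> \<alpha> * r ^ (m - n) * x n"
proof -
  obtain r where r: "0 < r" "r < 1" "\<And>n m. n \<le> m \<Longrightarrow> x m / x n \<le> \<alpha> * r ^ (m - n)"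
    and "\<And>n. 0 < x n"
    using assms by (auto simp: unif_exp_decay_with_def)
  then have "x m \<le> \<alpha> * r ^ (m - n) * x n" if "n \<le> m" for n m
    using r(3)[OF that] by (simp add: divide_le_eq)
  with r(1,2) show ?thesis by (rule that)
qed

lemma decay_mono:
  fixes r s \<alpha> \<beta> :: real
  assumes "x m \<le> \<alpha> * r ^ (m - n) * x n" "0 < r" "r \<le> s" "0 < \<alpha>" "\<alpha> \<le> \<beta>" "0 < x n"
  shows "x m \<le> \<beta> * s ^ (m - n) * x n"
proof -
  have "\<alpha> * r ^ (m - n) * x n \<le> \<beta> * s ^ (m - n) * x n"
    using assms by (intro mult_right_mono mult_mono power_mono) auto
  with assms(1) show ?thesis by (rule order_trans)
qed

theorem theorem1p5:
  fixes a l :: "nat \<Rightarrow> real" and b :: "nat \<Rightarrow> complex" and X :: seq_space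
  assumes a_pos: "\<forall>n. 0 < a n"
    and l_neg: "\<forall>n. l n < 0"
    and b_nz: "\<forall>n. b n \<noteq> 0"
    and X_space: "X \<in> {ell p |p. 1 \<le> p} \<union> {c_space, c0_space}"
    and a_bdd: "(\<lambda>n. complex_of_real (a n)) \<in> seqs (ell \<infinity>)"
    and a_conv: "X = c_space \<longrightarrow> (\<lambda>n. complex_of_real (a n)) \<in> seqs c_space"
    and b_in: "b \<in> seqs X"
    and C1: "unif_exp_decay_with 1 a" "unif_exp_decay_with 1 (\<lambda>n. \<bar>l n\<bar>)"
    and C2: "unif_exp_decay (\<lambda>n. norm (b n))"
    and C3: "unif_exp_decay (\<lambda>n. (a n - l n) / norm (b n))"
    and C4: "unif_exp_decay (\<lambda>n. a n / norm (b n))"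
    and C5: "\<exists>\<gamma> \<omega> :: nat \<Rightarrow> real.
        (\<forall>n. \<gamma> n \<le> \<bar>l n\<bar> / a n \<and> \<bar>l n\<bar> / a n \<le> \<omega> n) \<and>
        (\<forall>n. 0 < \<omega> n - 1) \<and> (\<forall>n. 0 < 1 / \<gamma> n - 1) \<and>
        (\<lambda>n. complex_of_real (\<omega> n - 1)) \<in> seqs (ell 1) \<and>
        (\<lambda>n. complex_of_real (1 / \<gamma> n - 1)) \<in> seqs (ell 1)"
  shows "let A = (\<lambda>n. complex_of_real (a n));
             k = gain A b (\<lambda>n. complex_of_real (l n))
         in k \<in> seq_dual X \<and>
            (X \<in> {ell p |p. 1 \<le> p} \<union> {c0_space} \<longrightarrow> diagonalizable X (feedback_op A b k))"
proof -
  define c where "c n = - l n" for n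
  have c_pos: "0 < c n" and abs_l: "\<bar>l n\<bar> = c n" for n
    using l_neg by (auto simp: c_def abs_of_neg)
  obtain ra where ra: "0 < ra" "ra < 1" "\<And>n m. n \<le> m \<Longrightarrow> a m \<le> 1 * ra ^ (m - n) * a n"
    using C1(1) by (rule unif_exp_decay_withE) blast
  obtain rc where rc: "0 < rc" "rc < 1" "\<And>n m. n \<le> m \<Longrightarrow> c m \<le> 1 * rc ^ (m - n) * c n"
    using C1(2) unfolding abs_l by (rule unif_exp_decay_withE) blast
  obtain Kb where Kb: "0 < Kb" "unif_exp_decay_with Kb (\<lambda>n. norm (b n))"
    using C2 by (auto simp: unif_exp_decay_def)
  obtain rb where rb: "0 < rb" "rb < 1"
    "\<And>n m. n \<le> m \<Longrightarrow> norm (b m) \<le> Kb * rb ^ (m - n) * norm (b n)"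
    using Kb(2) by (rule unif_exp_decay_withE) blast
  define g where "g n = (a n + c n) / norm (b n)" for n
  obtain Kg where Kg: "0 < Kg" "unif_exp_decay_with Kg g"
    using C3 by (auto simp: unif_exp_decay_def g_def[abs_def] c_def)
  obtain rg where rg: "0 < rg" "rg < 1" "\<And>n m. n \<le> m \<Longrightarrow> g m \<le> Kg * rg ^ (m - n) * g n"
    using Kg(2) by (rule unif_exp_decay_withE) blast
  obtain \<gamma> \<omega> where \<gamma>\<omega>: "\<And>n. \<gamma> n \<le> c n / a n" "\<And>n. c n / a n \<le> \<omega> n"
      "\<And>n. 0 < \<omega> n - 1" "\<And>n. 0 < 1 / \<gamma> n - 1"
    and s: "(\<lambda>n. complex_of_real (\<omega> n - 1)) \<in> seqs (ell 1)"
      "(\<lambda>n. complex_of_real (1 / \<gamma> n - 1)) \<in> seqs (ell 1)"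
    using C5 unfolding abs_l by blast
  define e where "e n = (\<omega> n - 1) + (1 / \<gamma> n - 1)" for n
  define r where "r = max (max ra rc) (max rb rg)"
  define K where "K = max Kb Kg"
  have g_pos: "0 < g n" for n
    using a_pos c_pos b_nz by (simp add: g_def add_pos_pos)
  interpret placement a c b e r K
  proof
    show "0 < r" "r < 1"
      using ra rb rc rg by (auto simp: r_def)
    show "0 < a n" "0 < c n" "b n \<noteq> 0" for n
      using a_pos c_pos b_nz by auto
    show "a m \<le> r ^ (m - n) * a n" if "n \<le> m" for n m
      using decay_mono[where x = a, OF ra(3)[OF that] ra(1), of r 1] a_pos by (simp add: r_def)
    show "c m \<le> r ^ (m - n) * c n" if "n \<le> m" for n m
      using decay_mono[where x = c, OF rc(3)[OF that] rc(1), of r 1] c_pos by (simp add: r_def)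
    show "norm (b m) \<le> K * r ^ (m - n) * norm (b n)" if "n \<le> m" for n m
      using decay_mono[where x = "\<lambda>n. norm (b n)", OF rb(3)[OF that] rb(1), of r K] Kb(1) b_nz
      by (simp add: r_def K_def)
    show "(a m + c m) / norm (b m) \<le> K * r ^ (m - n) * ((a n + c n) / norm (b n))"
      if "n \<le> m" for n m
      using decay_mono[where x = g, OF rg(3)[OF that] rg(1), of r K] Kg(1) g_pos
      unfolding g_def by (simp add: r_def K_def)
    show "0 \<le> e n" for n
      using \<gamma>\<omega>(3,4)[of n] by (simp add: e_def)
    have "summable (\<lambda>n. \<bar>\<omega> n - 1\<bar>)" "summable (\<lambda>n. \<bar>1 / \<gamma> n - 1\<bar>)"
      using s by (simp_all add: ell_def del: of_real_diff of_real_divide)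
    then show "summable e"
      unfolding e_def[abs_def] by (intro summable_add) (auto dest: summable_rabs_cancel)
    show "c n \<le> (1 + e n) * a n" for n
    proof -
      have "c n \<le> \<omega> n * a n"
        using \<gamma>\<omega>(2)[of n] a_pos by (simp add: divide_le_eq)
      also have "\<dots> \<le> (1 + e n) * a n"
        using \<gamma>\<omega>(4)[of n] a_pos by (intro mult_right_mono) (auto simp: e_def less_imp_le)
      finally show ?thesis .
    qed
    show "a n \<le> (1 + e n) * c n" for n
    proof -
      have "0 < \<gamma> n"
        using \<gamma>\<omega>(4)[of n] by (smt (verit) divide_nonpos_pos zero_less_divide_1_iff)
      then have "a n \<le> 1 / \<gamma> n * c n"
        using \<gamma>\<omega>(1)[of n] a_pos by (simp add: field_simps)
      also have "\<dots> \<le> (1 + e n) * c n"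
        using \<gamma>\<omega>(3)[of n] c_pos[of n] by (intro mult_right_mono) (auto simp: e_def)
      finally show ?thesis .
    qed
  qed
  have "(\<lambda>n. complex_of_real (l n)) = (\<lambda>n. - C n)"
    by (simp add: c_def)
  then show ?thesis
    using gains_in_dual[OF X_space] feedback_diagonalizable by (simp add: Let_def)
qed

end
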